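(* Let $I\subset\mathbb R\setminus\{0\}$ be an open interval, $f:I\to\mathbb R$ smooth with $f'^2>1$ everywhere on $I$, and let $C_1\neq0$ be a real constant. Let $M$ be the rotational hypersurface $\Gamma^t(s,t,w)=(f(s),\ -s\cos t\sin w,\ -s\sin t,\ s\cos t\cos w)$ in $\mathbb E_1^4$ with Gauss map $N^t=\frac1{\sqrt{f'^2-1}}(1,\ -f'\cos t\sin w,\ -f'\sin t,\ f'\cos t\cos w)$, and assume $L_1N^t$ is not identically zero. If the differential equation $$0=\left(1+C_1\sqrt{f'^2-1}\right)\Big(-2f'^2(f'^2-1)^3+2s(f'^2-1)f'^3f''-2s^2(4f'^2+1)f''^2+2s^2(f'^2-1)f'f'''\Big)-2s\Big(\big(f'(f'^2-1)-s(3f'^2+2)f''\big)f''+s(f'^2-1)f'f'''\Big)f'^2$$ holds on $I$, then $M$ has second kind $L_1$-pointwise 1-type Gauss map; namely $L_1N^t=\mathfrak m(N^t+C)$ for some non-zero smooth function $\mathfrak m$, with $C=(C_1,0,0,0)$.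
   Context: $\mathbb E_1^4$ is $\mathbb R^4$ with the Lorentzian metric $\langle\,,\rangle=-dx_1^2+dx_2^2+dx_3^2+dx_4^2$. Let $M$ be an oriented hypersurface of $\mathbb E_1^4$ with nondegenerate induced metric $g$, unit normal vector field (Gauss map) $N$, $\varepsilon=\langle N,N\rangle=\pm1$, shape operator $S=-dN$ and principal curvatures $\kappa_1,\kappa_2,\kappa_3$. Put $a_0=1$, $a_1=-(\kappa_1+\kappa_2+\kappa_3)$, $a_2=\kappa_1\kappa_2+\kappa_1\kappa_3+\kappa_2\kappa_3$, $a_3=-\kappa_1\kappa_2\kappa_3$. The Newton transformations are $P_0=I$, $P_k=a_kI+S\circ P_{k-1}$, and $L_k(\varphi)=\mathrm{tr}(P_k\circ\nabla^2\varphi)$ for $\varphi\in C^\infty(M)$, where $\nabla^2\varphi$ is the Hessian operator of $\varphi$ with respect to $g$; $L_k$ acts componentwise on $\mathbb R^4$-valued functions such as $N$. With $n=3$, $\binom{n}{k}H_k=(-\varepsilon)^ka_k$ and $C_k=\binom{n}{k+1}(-\varepsilon)^k$, the known formula used for the Gauss map is $L_kN=-\varepsilon C_k\big(\nabla H_{k+1}+(nH_1H_{k+1}-(n-k-1)H_{k+2})N\big)$, where $\nabla$ is the gradient of $g$. $M$ has second kind $L_k$-pointwise 1-type Gauss map if $L_kN=\mathfrak m(N+C)$ for a non-zero (i.e. not identically zero) smooth function $\mathfrak m$ on $M$ and a non-zero constant vector $C\in\mathbb E_1^4$. Primes denote $d/ds$; $s\in I$, $0\le t,w\le2\pi$, and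 the parametrization is considered where it is an immersion ($\cos t\neq0$). *)

theory Defs
  imports "HOL-Analysis.Analysis"
begin

(* An (immersed) hypersurface of E_1^4 is given by a parametrization X :: real^3 => real^4 on an
   open set U of parameters; its points are X ` U.  Functions, vector fields and operators on the
   hypersurface are written in the coordinates of U: a scalar function is its pullback phi to U,
   a tangent field is the coefficient vector v with respect to the frame d_1 X, d_2 X, d_3 X, and
   an endomorphism A of the tangent bundle is the matrix with A (d_j X) = (SUM i. A$i$j d_i X). *)

definition dir_deriv :: "'a::euclidean_space \<Rightarrow> ('a \<Rightarrow> 'b::real_normed_vector) \<Rightarrow> 'a \<Rightarrow> 'b"
  where "dir_deriv v \<phi> p = frechet_derivative \<phi> (at p) v"

text \<open>\<open>C\<^sup>\<infinity>\<close> on an open set: all iterated partial derivatives exist and are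
  (totally) differentiable, hence continuous.\<close>

definition smooth_on :: "'a::euclidean_space set \<Rightarrow> ('a \<Rightarrow> 'b::real_normed_vector) \<Rightarrow> bool"
  where "smooth_on U \<phi> \<longleftrightarrow>
    (\<forall>vs. set vs \<subseteq> Basis \<longrightarrow> (\<forall>p\<in>U. fold dir_deriv vs \<phi> differentiable (at p)))"

definition pd :: "3 \<Rightarrow> (real^3 \<Rightarrow> 'b::real_normed_vector) \<Rightarrow> real^3 \<Rightarrow> 'b"
  where "pd i = dir_deriv (axis i 1)"

definition lorentz :: "real^4 \<Rightarrow> real^4 \<Rightarrow> real"
  where "lorentz x y = - (x$1 * y$1) + x$2 * y$2 + x$3 * y$3 + x$4 * y$4"

definition metric :: "(real^3 \<Rightarrow> real^4) \<Rightarrow> real^3 \<Rightarrow> real^3^3"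
  where "metric X p = (\<chi> i j. lorentz (pd i X p) (pd j X p))"

(* A nonzero determinant of g also forces X to be an immersion. *)

definition oriented_hypersurface ::
    "(real^3) set \<Rightarrow> (real^3 \<Rightarrow> real^4) \<Rightarrow> (real^3 \<Rightarrow> real^4) \<Rightarrow> bool"
  where "oriented_hypersurface U X N \<longleftrightarrow>
    open U \<and> smooth_on U X \<and> smooth_on U N \<and>
    (\<forall>p\<in>U. det (metric X p) \<noteq> 0) \<and>
    (\<forall>p\<in>U. \<forall>i. lorentz (N p) (pd i X p) = 0) \<and>
    (\<exists>\<epsilon>\<in>{1, -1}. \<forall>p\<in>U. lorentz (N p) (N p) = \<epsilon>)"

text \<open>\<open>S = - dN\<close>, as an endomorphism of the tangent spaces.\<close>

definition shape_op :: "(real^3 \<Rightarrow> real^4) \<Rightarrow> (real^3 \<Rightarrow> real^4) \<Rightarrow> real^3 \<Rightarrow> real^3^3"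
  where "shape_op X N p =
    (THE S. \<forall>j. - pd j N p = (\<Sum>i\<in>UNIV. (S$i$j) *\<^sub>R pd i X p))"

(* The eigenvalues counted with algebraic multiplicity, in some order.  They are taken in the
   complex numbers because S is only self-adjoint for a possibly indefinite metric; their
   elementary symmetric functions are real. *)

definition principal_curvatures :: "real^3^3 \<Rightarrow> complex^3"
  where "principal_curvatures S =
    (SOME \<kappa>. \<forall>x. det (mat x - (\<chi> i j. complex_of_real (S$i$j))) = (\<Prod>i\<in>UNIV. x - \<kappa>$i))"

definition curv_coeff :: "real^3^3 \<Rightarrow> nat \<Rightarrow> real"
  where "curv_coeff S k = (let \<kappa> = principal_curvatures S in
    if k = 0 then 1
    else if k = 1 then - Re (\<kappa>$1 + \<kappa>$2 + \<kappa>$3)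
    else if k = 2 then Re (\<kappa>$1 * \<kappa>$2 + \<kappa>$1 * \<kappa>$3 + \<kappa>$2 * \<kappa>$3)
    else if k = 3 then - Re (\<kappa>$1 * \<kappa>$2 * \<kappa>$3)
    else 0)"

primrec newton :: "real^3^3 \<Rightarrow> nat \<Rightarrow> real^3^3"
  where
    "newton S 0 = mat 1"
  | "newton S (Suc k) = curv_coeff S (Suc k) *\<^sub>R mat 1 + S ** newton S k"

text \<open>Levi-Civita connection of the induced metric: \<open>christoffel X i j k\<close> is
  \<open>\<Gamma>\<^sup>k\<^sub>i\<^sub>j\<close>, and \<open>cov_deriv X v j\<close> is the covariant derivative of the field \<open>v\<close> in the
  direction of the \<open>j\<close>-th coordinate field.\<close>

definition christoffel :: "(real^3 \<Rightarrow> real^4) \<Rightarrow> 3 \<Rightarrow> 3 \<Rightarrow> 3 \<Rightarrow> real^3 \<Rightarrow> real"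
  where "christoffel X i j k p =
    (\<Sum>l\<in>UNIV. matrix_inv (metric X p) $ k $ l *
       (pd i (\<lambda>q. metric X q $ j $ l) p + pd j (\<lambda>q. metric X q $ i $ l) p
        - pd l (\<lambda>q. metric X q $ i $ j) p)) / 2"

definition cov_deriv :: "(real^3 \<Rightarrow> real^4) \<Rightarrow> (real^3 \<Rightarrow> real^3) \<Rightarrow> 3 \<Rightarrow> real^3 \<Rightarrow> real^3"
  where "cov_deriv X v j p =
    (\<chi> i. pd j (\<lambda>q. v q $ i) p + (\<Sum>k\<in>UNIV. christoffel X j k i p * v p $ k))"

definition gradient :: "(real^3 \<Rightarrow> real^4) \<Rightarrow> (real^3 \<Rightarrow> real) \<Rightarrow> real^3 \<Rightarrow> real^3"
  where "gradient X \<phi> p = matrix_inv (metric X p) *v (\<chi> j. pd j \<phi> p)"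

text \<open>The Hessian operator sends a tangent vector \<open>v\<close> to \<open>\<nabla>\<^sub>v (\<nabla> \<phi>)\<close>.\<close>

definition hessian_op :: "(real^3 \<Rightarrow> real^4) \<Rightarrow> (real^3 \<Rightarrow> real) \<Rightarrow> real^3 \<Rightarrow> real^3^3"
  where "hessian_op X \<phi> p = (\<chi> i j. cov_deriv X (gradient X \<phi>) j p $ i)"

definition L_op ::
    "nat \<Rightarrow> (real^3 \<Rightarrow> real^4) \<Rightarrow> (real^3 \<Rightarrow> real^4) \<Rightarrow> (real^3 \<Rightarrow> real) \<Rightarrow> real^3 \<Rightarrow> real"
  where "L_op k X N \<phi> p = trace (newton (shape_op X N p) k ** hessian_op X \<phi> p)"

definition L_vec ::
    "nat \<Rightarrow> (real^3 \<Rightarrow> real^4) \<Rightarrow> (real^3 \<Rightarrow> real^4) \<Rightarrow> (real^3 \<Rightarrow> real^4) \<Rightarrow> real^3 \<Rightarrow> real^4"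
  where "L_vec k X N \<Phi> p = (\<chi> i. L_op k X N (\<lambda>q. \<Phi> q $ i) p)"

(* The factor m is a function on the points of the hypersurface, not merely on the parameters;
   it is smooth there when its pullback m o X is smooth. *)

definition L_gauss_eq ::
    "nat \<Rightarrow> (real^3) set \<Rightarrow> (real^3 \<Rightarrow> real^4) \<Rightarrow> (real^3 \<Rightarrow> real^4) \<Rightarrow> (real^4 \<Rightarrow> real) \<Rightarrow> real^4 \<Rightarrow> bool"
  where "L_gauss_eq k U X N m C \<longleftrightarrow>
    smooth_on U (m \<circ> X) \<and> (\<exists>x\<in>X ` U. m x \<noteq> 0) \<and>
    (\<forall>p\<in>U. L_vec k X N N p = m (X p) *\<^sub>R (N p + C))"

definition second_kind_L_pointwise_1_type ::
    "nat \<Rightarrow> (real^3) set \<Rightarrow> (real^3 \<Rightarrow> real^4) \<Rightarrow> (real^3 \<Rightarrow> real^4) \<Rightarrow> bool"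
  where "second_kind_L_pointwise_1_type k U X N \<longleftrightarrow>
    oriented_hypersurface U X N \<and> (\<exists>m C. C \<noteq> 0 \<and> L_gauss_eq k U X N m C)"

text \<open>Parameters are \<open>(s, t, w)\<close>.  Everything is \<open>2\<pi>\<close>-periodic in \<open>t\<close> and \<open>w\<close>, so letting them
  range over the reals gives the same hypersurface as \<open>0 \<le> t, w \<le> 2\<pi>\<close>, with an open set of
  parameters.\<close>

definition rot_dom :: "real set \<Rightarrow> (real^3) set"
  where "rot_dom I = {p. p$1 \<in> I \<and> cos (p$2) \<noteq> 0}"

definition rot_param :: "(real \<Rightarrow> real) \<Rightarrow> real^3 \<Rightarrow> real^4"
  where "rot_param f p = (let s = p$1; t = p$2; w = p$3 in
    vector [f s, - s * cos t * sin w, - s * sin t, s * cos t * cos w])"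

definition rot_gauss :: "(real \<Rightarrow> real) \<Rightarrow> real^3 \<Rightarrow> real^4"
  where "rot_gauss f p = (let s = p$1; t = p$2; w = p$3; f' = deriv f s in
    (1 / sqrt (f'\<^sup>2 - 1)) *\<^sub>R
      vector [1, - f' * cos t * sin w, - f' * sin t, f' * cos t * cos w])"

end

theory Submission
  imports Defs
begin

text \<open>With \<open>h = f'\<close> and \<open>W = sqrt (h\<^sup>2 - 1)\<close>, the frame \<open>\<partial>\<^sub>s, \<partial>\<^sub>t, \<partial>\<^sub>w\<close> is orthogonal and diagonalizes the
  shape operator, with principal curvatures \<open>h' / W\<^sup>3\<close> and, twice, \<open>- h / (s W)\<close>.  The components of the
  Gauss map are radial functions times spherical harmonics (\<open>1 / W\<close> times a constant, \<open>h / W\<close> times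
  linear ones), and \<open>L\<^sub>1\<close> preserves such products.  So \<open>L\<^sub>1 N\<close> has the same shape as \<open>N\<close>, with radial
  functions \<open>A\<close> and \<open>B\<close> in place of \<open>1 / W\<close> and \<open>h / W\<close>.  The factor must then be \<open>W B / h\<close>, and the
  differential equation says exactly that \<open>h A = (1 + C\<^sub>1 W) B\<close>, which is the remaining component.\<close>

subsection \<open>Smooth functions\<close>

lemma dir_derivI:
  "(\<phi> has_derivative D) (at p) \<Longrightarrow> dir_deriv v \<phi> p = D v"
  unfolding dir_deriv_def by (metis frechet_derivative_at)

lemma has_derivative_dir_deriv:
  "\<phi> differentiable (at p) \<Longrightarrow> (\<phi> has_derivative (\<lambda>v. dir_deriv v \<phi> p)) (at p)"
  unfolding dir_deriv_def by (simp add: frechet_derivative_works)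

text \<open>\<open>frechet_derivative\<close> selects by Hilbert choice among all derivatives at the
  point. Both functions have the same candidates there, so the selected maps agree even at points of
  non-differentiability.\<close>

lemma dir_deriv_cong:
  assumes "open U" "p \<in> U" "\<And>q. q \<in> U \<Longrightarrow> \<phi> q = \<psi> q"
  shows "dir_deriv v \<phi> p = dir_deriv v \<psi> p"
proof -
  have "(\<phi> has_derivative D) (at p) \<longleftrightarrow> (\<psi> has_derivative D) (at p)" for D
    using assms by (metis has_derivative_transform_within_open)
  then show ?thesis
    by (simp add: dir_deriv_def frechet_derivative_def)
qed

lemma differentiable_cong_open:
  assumes "open U" "p \<in> U" "\<And>q. q \<in> U \<Longrightarrow> \<phi> q = \<psi> q" "\<psi> differentiable (at p)"
  shows "\<phi> differentiable (at p)"
  using assms unfolding differentiable_def by (metis has_derivative_transform_within_open)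

lemma fold_dir_deriv_cong:
  assumes "open U" "\<And>q. q \<in> U \<Longrightarrow> \<phi> q = \<psi> q" "p \<in> U"
  shows "fold dir_deriv vs \<phi> p = fold dir_deriv vs \<psi> p"
  using assms(2,3)
proof (induction vs arbitrary: \<phi> \<psi> p)
  case (Cons v vs)
  have "fold dir_deriv vs (dir_deriv v \<phi>) p = fold dir_deriv vs (dir_deriv v \<psi>) p"
    by (rule Cons.IH[OF dir_deriv_cong[OF assms(1) _ Cons.prems(1)] Cons.prems(2)])
  then show ?case by simp
qed simp

lemma fold_dir_deriv_differentiable_cong:
  assumes "open U" "\<And>q. q \<in> U \<Longrightarrow> \<phi> q = \<psi> q" "p \<in> U"
    and "fold dir_deriv vs \<psi> differentiable (at p)"
  shows "fold dir_deriv vs \<phi> differentiable (at p)"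
proof -
  have "fold dir_deriv vs \<phi> q = fold dir_deriv vs \<psi> q" if "q \<in> U" for q
    by (rule fold_dir_deriv_cong[OF assms(1,2) that])
  with differentiable_cong_open[OF assms(1,3) _ assms(4)] show ?thesis by blast
qed

lemma smooth_on_cong:
  assumes "open U" "\<And>q. q \<in> U \<Longrightarrow> \<phi> q = \<psi> q" "smooth_on U \<psi>"
  shows "smooth_on U \<phi>"
  unfolding smooth_on_def
proof (intro allI impI ballI)
  fix vs :: "'a list" and p assume "set vs \<subseteq> Basis" "p \<in> U"
  then have "fold dir_deriv vs \<psi> differentiable (at p)"
    using assms(3) unfolding smooth_on_def by blast
  then show "fold dir_deriv vs \<phi> differentiable (at p)"
    using fold_dir_deriv_differentiable_cong[OF assms(1,2) \<open>p \<in> U\<close>] by simp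
qed

lemma smooth_on_imp_differentiable:
  "smooth_on U \<phi> \<Longrightarrow> p \<in> U \<Longrightarrow> \<phi> differentiable (at p)"
  unfolding smooth_on_def by (metis empty_subsetI fold_simps(1) list.set(1))

lemma smooth_on_dir_deriv:
  assumes "smooth_on U \<phi>" "v \<in> Basis"
  shows "smooth_on U (dir_deriv v \<phi>)"
  unfolding smooth_on_def
proof (intro allI impI ballI)
  fix vs :: "'a list" and p assume "set vs \<subseteq> Basis" "p \<in> U"
  then show "fold dir_deriv vs (dir_deriv v \<phi>) differentiable (at p)"
    using assms(1)[unfolded smooth_on_def, rule_format, of "v # vs" p] assms(2) by simp
qed

text \<open>\<open>P\<close> is an invariant: it grants differentiability and survives every partial
  derivative, so it passes along any list of directions. Membership in \<open>P\<close> up to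
  equality on \<open>U\<close> suffices, because values outside the open set \<open>U\<close> do not
  affect derivatives inside it.\<close>

lemma smooth_on_coinduct:
  assumes "open U" "P \<phi>"
    and diff: "\<And>\<phi> p. P \<phi> \<Longrightarrow> p \<in> U \<Longrightarrow> \<phi> differentiable (at p)"
    and deriv: "\<And>\<phi> v. P \<phi> \<Longrightarrow> v \<in> Basis \<Longrightarrow> \<exists>\<psi>. P \<psi> \<and> (\<forall>p\<in>U. dir_deriv v \<phi> p = \<psi> p)"
  shows "smooth_on U \<phi>"
proof -
  have "set vs \<subseteq> Basis \<longrightarrow> p \<in> U \<longrightarrow> fold dir_deriv vs \<phi> differentiable (at p)" for vs p
    using \<open>P \<phi>\<close>
  proof (induction vs arbitrary: \<phi>)
    case Nil
    then show ?case using diff by simp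
  next
    case (Cons v vs)
    show ?case
    proof (intro impI)
      assume v: "set (v # vs) \<subseteq> Basis" "p \<in> U"
      then obtain \<psi> where "P \<psi>" and \<psi>: "\<And>p. p\<in>U \<Longrightarrow> dir_deriv v \<phi> p = \<psi> p"
        using deriv[OF Cons.prems, of v] by auto
      then have "fold dir_deriv vs \<psi> differentiable (at p)"
        using Cons.IH v by auto
      then show "fold dir_deriv (v # vs) \<phi> differentiable (at p)"
        using fold_dir_deriv_differentiable_cong[OF \<open>open U\<close> \<psi> \<open>p \<in> U\<close>] by simp
    qed
  qed
  then show ?thesis
    unfolding smooth_on_def by blast
qed

text \<open>Negation is expressed as a product with the constant -1, which explains the coefficients
  \<open>- 1\<close> below. The inductive form lets the Leibniz rule run by induction on how a
  function is built.\<close>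

inductive fun_algebra :: "('a \<Rightarrow> real) set \<Rightarrow> ('a \<Rightarrow> real) \<Rightarrow> bool" for S where
  gen: "\<phi> \<in> S \<Longrightarrow> fun_algebra S \<phi>"
| const: "fun_algebra S (\<lambda>_. c)"
| add: "fun_algebra S \<phi> \<Longrightarrow> fun_algebra S \<psi> \<Longrightarrow> fun_algebra S (\<lambda>p. \<phi> p + \<psi> p)"
| mult: "fun_algebra S \<phi> \<Longrightarrow> fun_algebra S \<psi> \<Longrightarrow> fun_algebra S (\<lambda>p. \<phi> p * \<psi> p)"

text \<open>By the Leibniz rule it suffices that the partial derivatives of the generators stay in the
  generated algebra.\<close>

lemma smooth_on_fun_algebra:
  assumes "open U"
    and diff: "\<And>\<phi> p. \<phi> \<in> S \<Longrightarrow> p \<in> U \<Longrightarrow> \<phi> differentiable (at p)"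
    and deriv: "\<And>\<phi> v. \<phi> \<in> S \<Longrightarrow> v \<in> Basis \<Longrightarrow>
      \<exists>\<psi>. fun_algebra S \<psi> \<and> (\<forall>p\<in>U. dir_deriv v \<phi> p = \<psi> p)"
    and "fun_algebra S \<phi>"
  shows "smooth_on U \<phi>"
proof -
  have *: "(\<forall>p\<in>U. \<phi> differentiable (at p)) \<and>
      (\<forall>v\<in>Basis. \<exists>\<psi>. fun_algebra S \<psi> \<and> (\<forall>p\<in>U. dir_deriv v \<phi> p = \<psi> p))"
    if "fun_algebra S \<phi>" for \<phi>
    using that
  proof induction
    case (gen \<phi>)
    then show ?case using diff deriv by blast
  next
    case (const c)
    have "dir_deriv v (\<lambda>_. c) p = 0" for v p
      by (rule dir_derivI) simp
    then show ?case
      using fun_algebra.const[of S 0] by auto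
  next
    case (add \<phi> \<psi>)
    have "\<exists>\<eta>. fun_algebra S \<eta> \<and> (\<forall>p\<in>U. dir_deriv v (\<lambda>p. \<phi> p + \<psi> p) p = \<eta> p)"
      if "v \<in> Basis" for v
    proof -
      from add that obtain \<phi>' \<psi>' where
        "fun_algebra S \<phi>'" "\<forall>p\<in>U. dir_deriv v \<phi> p = \<phi>' p"
        "fun_algebra S \<psi>'" "\<forall>p\<in>U. dir_deriv v \<psi> p = \<psi>' p" by blast
      moreover have "dir_deriv v (\<lambda>p. \<phi> p + \<psi> p) p = dir_deriv v \<phi> p + dir_deriv v \<psi> p"
        if "p \<in> U" for p
        using add that by (intro dir_derivI has_derivative_add has_derivative_dir_deriv) auto
      ultimately show ?thesis
        by (intro exI[of _ "\<lambda>p. \<phi>' p + \<psi>' p"]) (auto intro: fun_algebra.add)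
    qed
    with add show ?case by auto
  next
    case (mult \<phi> \<psi>)
    have "\<exists>\<eta>. fun_algebra S \<eta> \<and> (\<forall>p\<in>U. dir_deriv v (\<lambda>p. \<phi> p * \<psi> p) p = \<eta> p)"
      if "v \<in> Basis" for v
    proof -
      from mult that obtain \<phi>' \<psi>' where
        "fun_algebra S \<phi>'" "\<forall>p\<in>U. dir_deriv v \<phi> p = \<phi>' p"
        "fun_algebra S \<psi>'" "\<forall>p\<in>U. dir_deriv v \<psi> p = \<psi>' p" by blast
      moreover have "dir_deriv v (\<lambda>p. \<phi> p * \<psi> p) p
          = \<phi> p * dir_deriv v \<psi> p + dir_deriv v \<phi> p * \<psi> p" if "p \<in> U" for p
        using mult that by (intro dir_derivI has_derivative_mult has_derivative_dir_deriv) auto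
      ultimately show ?thesis
        using mult.hyps
        by (intro exI[of _ "\<lambda>p. \<phi> p * \<psi>' p + \<phi>' p * \<psi> p"])
          (auto intro!: fun_algebra.add fun_algebra.mult)
    qed
    with mult show ?case by auto
  qed
  show ?thesis
    using * by (intro smooth_on_coinduct[of U "fun_algebra S", OF assms(1,4)]) simp_all
qed

section \<open>Sums, products, reciprocals, inverse roots and vectors of smooth functions\<close>

lemma smooth_on_algebra_smooth:
  assumes "open U" "fun_algebra {\<phi>. smooth_on U \<phi>} \<phi>"
  shows "smooth_on U \<phi>"
proof (rule smooth_on_fun_algebra[OF assms(1) _ _ assms(2)])
  fix \<phi> :: "'a \<Rightarrow> real" and v :: 'a assume "\<phi> \<in> {\<phi>. smooth_on U \<phi>}" "v \<in> Basis"
  then show "\<exists>\<psi>. fun_algebra {\<phi>. smooth_on U \<phi>} \<psi> \<and> (\<forall>p\<in>U. dir_deriv v \<phi> p = \<psi> p)"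
    by (intro exI[of _ "dir_deriv v \<phi>"]) (auto intro: fun_algebra.gen smooth_on_dir_deriv)
qed (auto intro: smooth_on_imp_differentiable)

lemma smooth_on_const: "open U \<Longrightarrow> smooth_on U (\<lambda>_. c::real)"
  by (rule smooth_on_algebra_smooth) (auto intro: fun_algebra.const)

lemma smooth_on_add:
  fixes \<phi> \<psi> :: "'a::euclidean_space \<Rightarrow> real"
  shows "open U \<Longrightarrow> smooth_on U \<phi> \<Longrightarrow> smooth_on U \<psi> \<Longrightarrow> smooth_on U (\<lambda>p. \<phi> p + \<psi> p)"
  by (rule smooth_on_algebra_smooth, assumption, rule fun_algebra.add; rule fun_algebra.gen; simp)

lemma smooth_on_mult:
  fixes \<phi> \<psi> :: "'a::euclidean_space \<Rightarrow> real"
  shows "open U \<Longrightarrow> smooth_on U \<phi> \<Longrightarrow> smooth_on U \<psi> \<Longrightarrow> smooth_on U (\<lambda>p. \<phi> p * \<psi> p)"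
  by (rule smooth_on_algebra_smooth, assumption, rule fun_algebra.mult; rule fun_algebra.gen; simp)

text \<open>Meant for functions \<open>r\<close> whose derivative is a polynomial in
  \<open>r\<close> and smooth functions, such as reciprocals and inverse square roots. The algebra
  generated by \<open>r\<close> and all smooth functions is then closed under differentiation,
  although the smoothness of \<open>r\<close> is not known beforehand.\<close>

lemma smooth_on_adjoin:
  fixes r :: "'a::euclidean_space \<Rightarrow> real"
  assumes "open U" and D: "\<And>p. p \<in> U \<Longrightarrow> (r has_derivative D p) (at p)"
    and alg: "\<And>v. v \<in> Basis \<Longrightarrow> fun_algebra (insert r {\<psi>. smooth_on U \<psi>}) (\<lambda>p. D p v)"
  shows "smooth_on U r"
proof -
  let ?S = "insert r {\<psi>. smooth_on U \<psi>}"
  show ?thesis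
    using assms(1)
  proof (rule smooth_on_fun_algebra[where S = ?S])
    fix \<psi> and v :: 'a assume \<psi>: "\<psi> \<in> ?S" and v: "v \<in> Basis"
    then show "\<exists>\<eta>. fun_algebra ?S \<eta> \<and> (\<forall>p\<in>U. dir_deriv v \<psi> p = \<eta> p)"
    proof (cases "smooth_on U \<psi>")
      case True
      then show ?thesis
        using v by (intro exI[of _ "dir_deriv v \<psi>"]) (auto intro: fun_algebra.gen smooth_on_dir_deriv)
    next
      case False
      with \<psi> dir_derivI[OF D] alg[OF v] show ?thesis by auto
    qed
  qed (auto intro: fun_algebra.gen smooth_on_imp_differentiable differentiableI[OF D])
qed

lemma smooth_on_inverse:
  fixes \<phi> :: "'a::euclidean_space \<Rightarrow> real"
  assumes "open U" "smooth_on U \<phi>" and nz: "\<And>p. p \<in> U \<Longrightarrow> \<phi> p \<noteq> 0"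
  shows "smooth_on U (\<lambda>p. inverse (\<phi> p))"
  using assms(1)
proof (rule smooth_on_adjoin)
  show "((\<lambda>p. inverse (\<phi> p)) has_derivative
      (\<lambda>v. - 1 * (dir_deriv v \<phi> p * (inverse (\<phi> p) * inverse (\<phi> p))))) (at p)" if "p \<in> U" for p
    using nz[OF that] has_derivative_dir_deriv[OF smooth_on_imp_differentiable[OF assms(2) that]]
    by (auto intro!: derivative_eq_intros)
  show "fun_algebra (insert (\<lambda>p. inverse (\<phi> p)) {\<psi>. smooth_on U \<psi>})
      (\<lambda>p. - 1 * (dir_deriv v \<phi> p * (inverse (\<phi> p) * inverse (\<phi> p))))" if "v \<in> Basis" for v
    using assms(2) that
    by (intro fun_algebra.mult fun_algebra.const) (auto intro: fun_algebra.gen smooth_on_dir_deriv)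
qed

lemma smooth_on_inverse_sqrt:
  fixes \<phi> :: "'a::euclidean_space \<Rightarrow> real"
  assumes "open U" "smooth_on U \<phi>" and pos: "\<And>p. p \<in> U \<Longrightarrow> \<phi> p > 0"
  shows "smooth_on U (\<lambda>p. inverse (sqrt (\<phi> p)))"
  using assms(1)
proof (rule smooth_on_adjoin)
  let ?r = "\<lambda>p. inverse (sqrt (\<phi> p))"
  \<comment> \<open>For \<open>?r\<close> = \<phi>^(-1/2) the derivative is -1/2 times the
    derivative of \<phi> times \<open>?r\<close>^3, a polynomial without any further root or
    quotient.\<close>
  show "(?r has_derivative (\<lambda>v. - 1 / 2 * (dir_deriv v \<phi> p * (?r p * (?r p * ?r p))))) (at p)"
    if "p \<in> U" for p
    using pos[OF that] has_derivative_dir_deriv[OF smooth_on_imp_differentiable[OF assms(2) that]]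
    by (auto intro!: derivative_eq_intros simp: fun_eq_iff)
  show "fun_algebra (insert ?r {\<psi>. smooth_on U \<psi>})
      (\<lambda>p. - 1 / 2 * (dir_deriv v \<phi> p * (?r p * (?r p * ?r p))))" if "v \<in> Basis" for v
    using assms(2) that
    by (intro fun_algebra.mult fun_algebra.const) (auto intro: fun_algebra.gen smooth_on_dir_deriv)
qed

lemma smooth_on_vec:
  fixes \<phi> :: "'n::finite \<Rightarrow> 'a::euclidean_space \<Rightarrow> real"
  assumes "open U" "\<And>i. smooth_on U (\<phi> i)"
  shows "smooth_on U (\<lambda>p. \<chi> i. \<phi> i p)"
\<comment> \<open>The invariant ranges over all families of smooth components, since differentiation
  replaces every component by its partial derivative.\<close>
proof (rule smooth_on_coinduct[where P = "\<lambda>\<Phi>. \<exists>\<phi>. (\<forall>i. smooth_on U (\<phi> i)) \<and> \<Phi> = (\<lambda>p. \<chi> i. \<phi> i p)"])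
  have D: "((\<lambda>p. \<chi> i. \<phi> i p) has_derivative (\<lambda>v. \<chi> i. dir_deriv v (\<phi> i) p)) (at p)"
    if "\<forall>i. smooth_on U (\<phi> i)" "p \<in> U" for \<phi> :: "'n \<Rightarrow> 'a \<Rightarrow> real" and p
    using that unfolding has_derivative_componentwise_within[of "\<lambda>p. \<chi> i. \<phi> i p"]
    by (auto simp: Basis_vec_def inner_axis intro: has_derivative_dir_deriv smooth_on_imp_differentiable)
  fix \<Phi> :: "'a \<Rightarrow> real^'n" assume "\<exists>\<phi>. (\<forall>i. smooth_on U (\<phi> i)) \<and> \<Phi> = (\<lambda>p. \<chi> i. \<phi> i p)"
  then obtain \<phi> where \<phi>: "\<forall>i. smooth_on U (\<phi> i)" "\<Phi> = (\<lambda>p. \<chi> i. \<phi> i p)" by blast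
  show "\<Phi> differentiable (at p)" if "p \<in> U" for p
    using D[OF \<phi>(1) that] \<phi>(2) by (auto simp: differentiable_def)
  show "\<exists>\<psi>. (\<exists>\<phi>. (\<forall>i. smooth_on U (\<phi> i)) \<and> \<psi> = (\<lambda>p. \<chi> i. \<phi> i p)) \<and> (\<forall>p\<in>U. dir_deriv v \<Phi> p = \<psi> p)"
    if "v \<in> Basis" for v
    using \<phi> that
    by (intro exI[of _ "\<lambda>p. \<chi> i. dir_deriv v (\<phi> i) p"] conjI exI[of _ "\<lambda>i. dir_deriv v (\<phi> i)"])
      (auto intro: smooth_on_dir_deriv simp: dir_derivI[OF D])
qed (use assms in auto)

section \<open>Smooth functions of one variable and their pullbacks along a coordinate\<close>

lemma dir_deriv_real: "\<phi> differentiable (at s) \<Longrightarrow> dir_deriv 1 \<phi> s = deriv \<phi> s"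
  for \<phi> :: "real \<Rightarrow> real"
  by (rule trans[OF dir_derivI[of _ "(*) (deriv \<phi> s)"]])
    (auto simp: DERIV_deriv_iff_real_differentiable simp flip: has_field_derivative_def)

lemma smooth_on_deriv:
  fixes \<phi> :: "real \<Rightarrow> real"
  assumes "open I" "smooth_on I \<phi>"
  shows "smooth_on I (deriv \<phi>)"
  by (rule smooth_on_cong[OF assms(1) _ smooth_on_dir_deriv[OF assms(2), of 1]])
    (auto simp: dir_deriv_real smooth_on_imp_differentiable[OF assms(2)])

lemma smooth_on_has_deriv:
  fixes \<phi> :: "real \<Rightarrow> real"
  shows "smooth_on I \<phi> \<Longrightarrow> s \<in> I \<Longrightarrow> (\<phi> has_real_derivative deriv \<phi> s) (at s)"
  by (simp add: DERIV_deriv_iff_real_differentiable smooth_on_imp_differentiable)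

text \<open>By the chain rule the derivative in direction \<open>v\<close> is the constant
  \<open>v $ i\<close> times the pullback of \<open>deriv \<psi>\<close>. The pullbacks of smooth
  functions along one coordinate therefore generate an algebra closed under differentiation.\<close>

lemma smooth_on_component:
  fixes \<phi> :: "real \<Rightarrow> real"
  assumes "open U" "open I" "smooth_on I \<phi>" "\<And>p. p \<in> U \<Longrightarrow> p $ i \<in> I"
  shows "smooth_on U (\<lambda>p::real^'n. \<phi> (p $ i))"
proof -
  let ?S = "{\<lambda>p::real^'n. \<psi> (p $ i) |\<psi>. smooth_on I \<psi>}"
  have D: "((\<lambda>p. \<psi> (p $ i)) has_derivative (\<lambda>v. v $ i * deriv \<psi> (p $ i))) (at p)"
    if "smooth_on I \<psi>" "p \<in> U" for \<psi> and p :: "real^'n"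
    using has_derivative_compose[OF bounded_linear_imp_has_derivative[OF bounded_linear_vec_nth]
      smooth_on_has_deriv[OF that(1) assms(4)[OF that(2)], unfolded has_field_derivative_def]]
    by (simp add: mult.commute)
  show ?thesis
    using assms(1)
  proof (rule smooth_on_fun_algebra[where S = ?S])
    fix \<phi> :: "real^'n \<Rightarrow> real" and v :: "real^'n" assume "\<phi> \<in> ?S"
    then obtain \<psi> where "smooth_on I \<psi>" "\<phi> = (\<lambda>p. \<psi> (p $ i))" by blast
    then show "\<exists>\<eta>. fun_algebra ?S \<eta> \<and> (\<forall>p\<in>U. dir_deriv v \<phi> p = \<eta> p)"
      using smooth_on_deriv[OF assms(2)]
      by (intro exI[of _ "\<lambda>p. v $ i * deriv \<psi> (p $ i)"])
        (auto simp: dir_derivI[OF D] intro!: fun_algebra.mult intro: fun_algebra.const fun_algebra.gen)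
  qed (use assms(3) in \<open>auto intro: fun_algebra.gen differentiableI[OF D]\<close>)
qed

lemma smooth_on_id: "open I \<Longrightarrow> smooth_on I (\<lambda>s::real. s)"
proof (rule smooth_on_fun_algebra[where S = "{\<lambda>s. s}"])
  fix \<phi> :: "real \<Rightarrow> real" and v assume "\<phi> \<in> {\<lambda>s. s}"
  then show "\<exists>\<psi>. fun_algebra {\<lambda>s. s} \<psi> \<and> (\<forall>p\<in>I. dir_deriv v \<phi> p = \<psi> p)"
    using fun_algebra.const[of _ v] dir_derivI[OF has_derivative_ident] by auto
qed (auto intro: fun_algebra.gen)

lemma smooth_on_sin_cos: "smooth_on UNIV (sin :: real \<Rightarrow> real)" "smooth_on UNIV (cos :: real \<Rightarrow> real)"
proof -
  have D: "dir_deriv v sin p = v * cos p" "dir_deriv v cos p = (- v) * sin p" for v p :: real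
    by (auto intro!: dir_derivI derivative_eq_intros)
  have "\<exists>\<psi>. fun_algebra {sin, cos} \<psi> \<and> (\<forall>p\<in>UNIV. dir_deriv v \<phi> p = \<psi> p)"
    if "\<phi> \<in> {sin, cos}" for v :: real and \<phi>
  proof -
    have "fun_algebra {sin, cos} (\<lambda>p::real. v * cos p)" "fun_algebra {sin, cos} (\<lambda>p::real. (- v) * sin p)"
      by (intro fun_algebra.mult fun_algebra.const; rule fun_algebra.gen; simp)+
    then show ?thesis using that D by auto
  qed
  note alg = smooth_on_fun_algebra[of UNIV "{sin, cos}", OF open_UNIV _ this]
  show "smooth_on UNIV (sin :: real \<Rightarrow> real)" "smooth_on UNIV (cos :: real \<Rightarrow> real)"
    by (rule alg; auto intro: fun_algebra.gen
      field_differentiable_imp_differentiable field_differentiable_within_sin field_differentiable_within_cos)+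
qed

subsection \<open>Orthogonal coordinates and diagonal shape operators\<close>

lemma vector_4 [simp]:
  "(vector [a, b, c, d] :: 'a::zero^4) $ 1 = a"
  "(vector [a, b, c, d] :: 'a::zero^4) $ 2 = b"
  "(vector [a, b, c, d] :: 'a::zero^4) $ 3 = c"
  "(vector [a, b, c, d] :: 'a::zero^4) $ 4 = d"
  unfolding vector_def by simp_all

lemma pd_cong:
  "open U \<Longrightarrow> p \<in> U \<Longrightarrow> (\<And>q. q \<in> U \<Longrightarrow> \<phi> q = \<psi> q) \<Longrightarrow> pd i \<phi> p = pd i \<psi> p"
  unfolding pd_def by (rule dir_deriv_cong)

lemma pd_vec_nth:
  fixes \<Phi> :: "real^3 \<Rightarrow> real^'n"
  assumes "\<Phi> differentiable (at p)"
  shows "pd i \<Phi> p $ c = pd i (\<lambda>q. \<Phi> q $ c) p"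
proof -
  have "((\<lambda>q. \<Phi> q $ c) has_derivative (\<lambda>v. dir_deriv v \<Phi> p $ c)) (at p)"
    using has_derivative_dir_deriv[OF assms] by (rule bounded_linear.has_derivative[OF bounded_linear_vec_nth])
  from dir_derivI[OF this] show ?thesis
    by (simp add: pd_def)
qed

text \<open>The components of \<open>X\<close> and \<open>N\<close>, the metric coefficients and the
  functions to which L_1 is applied all split into one-variable factors, so this product rule
  supplies the partial derivatives computed below. An absent factor is the constant 1.\<close>

lemma pd_separated:
  assumes "open U" "p \<in> U" "\<And>q. q \<in> U \<Longrightarrow> \<phi> q = F (q$1) * G (q$2) * K (q$3)"
    and "(F has_real_derivative F') (at (p$1))"
    and "(G has_real_derivative G') (at (p$2))"
    and "(K has_real_derivative K') (at (p$3))"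
  shows "pd 1 \<phi> p = F' * G (p$2) * K (p$3)"
    and "pd 2 \<phi> p = F (p$1) * G' * K (p$3)"
    and "pd 3 \<phi> p = F (p$1) * G (p$2) * K'"
proof -
  have comp: "((\<lambda>q. H (q$i)) has_derivative (\<lambda>v. H' * v$i)) (at p)"
    if "(H has_real_derivative H') (at (p$i))" for H H' and i :: 3
    using has_derivative_compose[OF bounded_linear_imp_has_derivative[OF bounded_linear_vec_nth]
      that[unfolded has_field_derivative_def]] .
  have "((\<lambda>q. F (q$1) * G (q$2) * K (q$3)) has_derivative
    (\<lambda>v. F (p$1) * G (p$2) * (K' * v$3)
      + (F (p$1) * (G' * v$2) + F' * v$1 * G (p$2)) * K (p$3))) (at p)"
    by (intro has_derivative_mult comp assms)
  then have "pd i (\<lambda>q. F (q$1) * G (q$2) * K (q$3)) p = F (p$1) * G (p$2) * (K' * axis i 1$3)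
      + (F (p$1) * (G' * axis i 1$2) + F' * axis i 1$1 * G (p$2)) * K (p$3)" for i
    unfolding pd_def by (rule dir_derivI)
  then show "pd 1 \<phi> p = F' * G (p$2) * K (p$3)" "pd 2 \<phi> p = F (p$1) * G' * K (p$3)"
    "pd 3 \<phi> p = F (p$1) * G (p$2) * K'"
    using pd_cong[OF assms(1-3)] by (simp_all add: axis_def)
qed

section \<open>Diagonal matrices, the first Newton transformation and L_1 in orthogonal
  coordinates\<close>

definition diag_mat :: "(3 \<Rightarrow> real) \<Rightarrow> real^3^3"
  where "diag_mat d = (\<chi> i j. if i = j then d i else 0)"

lemma diag_mat_nth: "diag_mat d $ i $ j = (if i = j then d i else 0)"
  by (simp add: diag_mat_def)

lemma matrix_inv_eqI:
  fixes A B :: "real^'n^'n"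
  assumes "A ** B = mat 1" "B ** A = mat 1"
  shows "matrix_inv A = B"
proof -
  have "A ** matrix_inv A = mat 1 \<and> matrix_inv A ** A = mat 1"
    unfolding matrix_inv_def by (rule someI[of _ B]) (use assms in blast)
  then show ?thesis
    using assms by (metis matrix_mul_assoc matrix_mul_lid matrix_mul_rid)
qed

lemma diag_mat_mult: "(diag_mat d ** A) $ i $ j = d i * A $ i $ j"
  by (simp add: matrix_matrix_mult_def diag_mat_def if_distrib[of "\<lambda>x. x * _"] cong: if_cong)

lemma matrix_inv_diag_mat:
  assumes "\<And>i. d i \<noteq> 0"
  shows "matrix_inv (diag_mat d) = diag_mat (\<lambda>i. 1 / d i)"
  by (rule matrix_inv_eqI)
    (use assms in \<open>simp_all add: vec_eq_iff diag_mat_mult diag_mat_nth mat_def\<close>)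

text \<open>\<open>principal_curvatures\<close> is an unspecified choice of roots, with no control
  over their order. Only its characteristic polynomial is known, and the sum of the roots is
  recovered from that polynomial.\<close>

lemma curv_coeff_diag_mat: "curv_coeff (diag_mat d) 1 = - (d 1 + d 2 + d 3)"
proof -
  let ?P = "\<lambda>\<kappa>::complex^3. \<forall>x. det (mat x - (\<chi> i j. complex_of_real (diag_mat d $ i $ j)))
      = (\<Prod>i\<in>UNIV. x - \<kappa>$i)"
  have det: "det (mat x - (\<chi> i j. complex_of_real (diag_mat d $ i $ j)))
      = (x - of_real (d 1)) * (x - of_real (d 2)) * (x - of_real (d 3))" for x
    by (simp add: det_3 mat_def diag_mat_nth)
  have prod: "(\<Prod>i\<in>UNIV. x - \<kappa>$i) = (x - \<kappa>$1) * (x - \<kappa>$2) * (x - \<kappa>$3)"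
    for x and \<kappa> :: "complex^3"
    unfolding UNIV_3 by (simp add: mult.assoc)
  have "?P (\<chi> i. of_real (d i))"
    unfolding det prod by simp
  then have "?P (principal_curvatures (diag_mat d))"
    unfolding principal_curvatures_def by (rule someI)
  then obtain \<kappa> where \<kappa>: "\<kappa> = principal_curvatures (diag_mat d)"
    "\<And>x. (x - of_real (d 1)) * (x - of_real (d 2)) * (x - of_real (d 3))
      = (x - \<kappa>$1) * (x - \<kappa>$2) * (x - \<kappa>$3)"
    by (simp add: det prod)
  \<comment> \<open>The trace is \<open>p(0) - (p(1) + p(-1)) / 2\<close> for the characteristic polynomial \<open>p\<close>.\<close>
  have trace: "a + b + c = (0 - a) * (0 - b) * (0 - c)
      - ((1 - a) * (1 - b) * (1 - c) + (- 1 - a) * (- 1 - b) * (- 1 - c)) / 2" for a b c :: complex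
    by (simp add: field_simps)
  have "\<kappa>$1 + \<kappa>$2 + \<kappa>$3 = of_real (d 1 + d 2 + d 3)"
    unfolding of_real_add trace[of "\<kappa>$1"] trace[of "of_real (d 1)"] \<kappa>(2) ..
  then have "Re (\<kappa>$1 + \<kappa>$2 + \<kappa>$3) = d 1 + d 2 + d 3"
    by (simp only: Re_complex_of_real)
  then show ?thesis
    by (simp add: curv_coeff_def \<kappa>(1)[symmetric])
qed

lemma newton_1_diag_mat: "newton (diag_mat d) 1 = diag_mat (\<lambda>i. d i - (d 1 + d 2 + d 3))"
  unfolding One_nat_def newton.simps curv_coeff_diag_mat[unfolded One_nat_def] matrix_mul_rid
  by (simp add: vec_eq_iff diag_mat_nth mat_def)

lemma lorentz_commute: "lorentz x y = lorentz y x"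
  by (simp add: lorentz_def)

lemma lorentz_sum_left: "lorentz (\<Sum>i\<in>A. c i *\<^sub>R x i) y = (\<Sum>i\<in>A. c i * lorentz (x i) y)"
  by (induction A rule: infinite_finite_induct) (auto simp: lorentz_def algebra_simps)

text \<open>Every coordinate field is a principal direction, so existence is immediate. The work
  lies in the uniqueness demanded by \<open>THE\<close>, which follows from orthogonality and
  nondegeneracy of the frame.\<close>

lemma shape_op_eq_diag_mat:
  assumes "metric X p = diag_mat \<gamma>" "\<And>i. \<gamma> i \<noteq> 0"
    and "\<And>j. - pd j N p = \<kappa> j *\<^sub>R pd j X p"
  shows "shape_op X N p = diag_mat \<kappa>"
  unfolding shape_op_def
proof (rule the_equality)
  show "\<forall>j. - pd j N p = (\<Sum>i\<in>UNIV. (diag_mat \<kappa> $ i $ j) *\<^sub>R pd i X p)"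
    by (simp add: assms(3) diag_mat_nth if_distrib[of "\<lambda>x. x *\<^sub>R _"] cong: if_cong)
next
  fix S :: "real^3^3" assume S: "\<forall>j. - pd j N p = (\<Sum>i\<in>UNIV. (S $ i $ j) *\<^sub>R pd i X p)"
  have g: "lorentz (pd i X p) (pd k X p) = (if i = k then \<gamma> i else 0)" for i k
    using assms(1) by (simp add: metric_def diag_mat_def vec_eq_iff)
  \<comment> \<open>Pairing the defining equation with the k-th frame vector isolates one entry of
    \<open>S\<close>; the nonzero \<open>\<gamma> k\<close> is cancelled afterwards.\<close>
  have "S $ k $ j * \<gamma> k = (if k = j then \<kappa> k else 0) * \<gamma> k" for k j
  proof -
    have "S $ k $ j * \<gamma> k = lorentz (- pd j N p) (pd k X p)"
      by (simp add: S[rule_format] lorentz_sum_left g if_distrib[of "\<lambda>x. _ * x"] cong: if_cong)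
    also have "\<dots> = \<kappa> j * lorentz (pd j X p) (pd k X p)"
      by (simp add: assms(3) lorentz_def algebra_simps)
    finally show ?thesis by (simp add: g split: if_splits)
  qed
  then show "S = diag_mat \<kappa>"
    using assms(2) by (simp add: vec_eq_iff diag_mat_nth)
qed

text \<open>P_1 = S - tr(S) I is diagonal, so the trace sees only the diagonal of the Hessian
  operator. That diagonal involves only Christoffel symbols whose upper index is repeated below, and
  for an orthogonal metric these are half the logarithmic derivatives of
  \<open>\<gamma> i\<close>.\<close>

lemma L_op_1_diag:
  assumes "open U" "p \<in> U"
    and g: "\<And>q. q \<in> U \<Longrightarrow> metric X q = diag_mat (\<lambda>i. \<gamma> i q)"
    and nz: "\<And>i q. q \<in> U \<Longrightarrow> \<gamma> i q \<noteq> 0"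
    and S: "shape_op X N p = diag_mat \<kappa>"
  shows "L_op 1 X N \<phi> p = (\<Sum>i\<in>UNIV. (\<kappa> i - (\<kappa> 1 + \<kappa> 2 + \<kappa> 3)) *
    (pd i (\<lambda>q. pd i \<phi> q / \<gamma> i q) p
      + (\<Sum>k\<in>UNIV. pd k (\<gamma> i) p * pd k \<phi> p / (2 * \<gamma> i p * \<gamma> k p))))"
proof -
  have inv: "matrix_inv (metric X q) = diag_mat (\<lambda>i. 1 / \<gamma> i q)" if "q \<in> U" for q
    using g nz that by (simp add: matrix_inv_diag_mat)
  have grad: "gradient X \<phi> q $ i = pd i \<phi> q / \<gamma> i q" if "q \<in> U" for q i
    unfolding gradient_def inv[OF that]
    by (simp add: matrix_vector_mult_def diag_mat_nth if_distrib[of "\<lambda>x. x * _"] cong: if_cong)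
  have sym: "(\<lambda>q. metric X q $ k $ i) = (\<lambda>q. metric X q $ i $ k)" for i k
    by (simp add: metric_def lorentz_commute)
  \<comment> \<open>Only l = i survives in the sum against the inverse metric. The two derivatives
    of mixed entries cancel by symmetry, and the derivative of the diagonal entry remains.\<close>
  have chr: "christoffel X i k i p = pd k (\<gamma> i) p / (2 * \<gamma> i p)" for i k
  proof -
    have "christoffel X i k i p = pd k (\<lambda>q. metric X q $ i $ i) p / (2 * \<gamma> i p)"
      unfolding christoffel_def inv[OF assms(2)] sym[of k i]
      by (simp add: diag_mat_nth if_distrib[of "\<lambda>x. x * _"] sym[of k i] cong: if_cong)
    also have "pd k (\<lambda>q. metric X q $ i $ i) p = pd k (\<gamma> i) p"
      by (rule pd_cong[OF assms(1,2)]) (simp add: g diag_mat_nth)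
    finally show ?thesis .
  qed
  have hess: "hessian_op X \<phi> p $ i $ i = pd i (\<lambda>q. pd i \<phi> q / \<gamma> i q) p
      + (\<Sum>k\<in>UNIV. pd k (\<gamma> i) p * pd k \<phi> p / (2 * \<gamma> i p * \<gamma> k p))" for i
  proof -
    have "pd i (\<lambda>q. gradient X \<phi> q $ i) p = pd i (\<lambda>q. pd i \<phi> q / \<gamma> i q) p"
      by (rule pd_cong[OF assms(1,2)]) (rule grad)
    then show ?thesis
      by (simp add: hessian_op_def cov_deriv_def chr grad[OF assms(2)])
  qed
  show ?thesis
    unfolding L_op_def S newton_1_diag_mat trace_def diag_mat_mult hess ..
qed

subsection \<open>The rotational hypersurface\<close>

text \<open>The common form of \<open>X\<close>, \<open>N\<close> and, as it turns out, L_1 N: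
  \<open>a\<close> is the component along the time axis, and \<open>b\<close> multiplies the point
  of the unit 2-sphere with angles \<open>p$2\<close> and \<open>p$3\<close>.\<close>

definition rot_vec :: "(real \<Rightarrow> real) \<Rightarrow> (real \<Rightarrow> real) \<Rightarrow> real^3 \<Rightarrow> real^4"
  where "rot_vec a b p = vector [a (p$1), - b (p$1) * cos (p$2) * sin (p$3),
    - b (p$1) * sin (p$2), b (p$1) * cos (p$2) * cos (p$3)]"

lemma rot_param_eq: "rot_param f = rot_vec f (\<lambda>s. s)"
  by (simp add: fun_eq_iff rot_param_def rot_vec_def Let_def)

lemma rot_gauss_eq:
  "rot_gauss f = rot_vec (\<lambda>s. 1 / sqrt ((deriv f s)\<^sup>2 - 1)) (\<lambda>s. deriv f s / sqrt ((deriv f s)\<^sup>2 - 1))"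
  by (simp add: fun_eq_iff rot_gauss_def rot_vec_def Let_def vec_eq_iff forall_4)

lemma open_rot_dom:
  assumes "open I"
  shows "open (rot_dom I)"
proof -
  have "rot_dom I = (\<lambda>p. p$1) -` I \<inter> (\<lambda>p. cos (p$2)) -` (- {0})"
    by (auto simp: rot_dom_def)
  then show ?thesis
    using assms by (auto intro!: open_Int open_vimage continuous_intros)
qed

lemma smooth_on_rot_vec:
  assumes "open I" "smooth_on I a" "smooth_on I b"
  shows "smooth_on (rot_dom I) (rot_vec a b)"
proof -
  note U = open_rot_dom[OF assms(1)]
  have radial: "smooth_on (rot_dom I) (\<lambda>p. c (p$1))" 
    if "smooth_on I c" for c :: "real \<Rightarrow> real"
    by (rule smooth_on_component[OF U assms(1) that]) (simp add: rot_dom_def)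
  have angular: "smooth_on (rot_dom I) (\<lambda>p. sin (p$i))" "smooth_on (rot_dom I) (\<lambda>p. cos (p$i))" for i
    by (rule smooth_on_component[OF U open_UNIV smooth_on_sin_cos(1)]; simp)
      (rule smooth_on_component[OF U open_UNIV smooth_on_sin_cos(2)]; simp)
  have "smooth_on (rot_dom I) (\<lambda>p. rot_vec a b p $ i)" for i
  proof -
    have *: "smooth_on (rot_dom I) (\<lambda>p. -1 * b (p$1) * cos (p$2) * sin (p$3))"
      "smooth_on (rot_dom I) (\<lambda>p. -1 * b (p$1) * sin (p$2))"
      "smooth_on (rot_dom I) (\<lambda>p. b (p$1) * cos (p$2) * cos (p$3))"
      by (intro smooth_on_mult smooth_on_const U radial angular assms)+
    have "i = 1 \<or> i = 2 \<or> i = 3 \<or> i = 4"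
      by (rule exhaust_4)
    then show ?thesis
      using * radial[OF assms(2)] by (auto simp: rot_vec_def)
  qed
  from smooth_on_vec[where \<phi> = "\<lambda>i p. rot_vec a b p $ i", OF U this] show ?thesis by simp
qed

lemma pd_rot_vec:
  assumes "open I" "smooth_on I a" "smooth_on I b" "p \<in> rot_dom I"
    and "(a has_real_derivative a') (at (p$1))" "(b has_real_derivative b') (at (p$1))"
  shows "pd 1 (rot_vec a b) p = rot_vec (\<lambda>_. a') (\<lambda>_. b') p"
    and "pd 2 (rot_vec a b) p = b (p$1) *\<^sub>R
      vector [0, sin (p$2) * sin (p$3), - cos (p$2), - sin (p$2) * cos (p$3)]"
    and "pd 3 (rot_vec a b) p = b (p$1) *\<^sub>R
      vector [0, - cos (p$2) * cos (p$3), 0, - cos (p$2) * sin (p$3)]"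
proof -
  note nth = pd_vec_nth[OF smooth_on_imp_differentiable[OF smooth_on_rot_vec[OF assms(1-3)] assms(4)]]
  note sep = pd_separated[OF open_UNIV UNIV_I]
  have c1: "pd 1 (\<lambda>q. a (q$1)) p = a'" "pd 2 (\<lambda>q. a (q$1)) p = 0" "pd 3 (\<lambda>q. a (q$1)) p = 0"
    using sep[of "\<lambda>q. a (q$1)" a "\<lambda>_. 1" "\<lambda>_. 1", OF _ assms(5) DERIV_const DERIV_const] by simp_all
  have b': "((\<lambda>s. - b s) has_real_derivative - b') (at (p$1))"
    by (rule DERIV_minus[OF assms(6)])
  note c2 = sep[of "\<lambda>q. - b (q$1) * cos (q$2) * sin (q$3)", OF _ b' DERIV_cos DERIV_sin, OF refl]
  note c4 = sep[of "\<lambda>q. b (q$1) * cos (q$2) * cos (q$3)", OF _ assms(6) DERIV_cos DERIV_cos, OF refl]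
  note c3 = sep[of "\<lambda>q. - b (q$1) * sin (q$2)" _ _ "\<lambda>_. 1", OF _ b' DERIV_sin DERIV_const, simplified]
  show "pd 1 (rot_vec a b) p = rot_vec (\<lambda>_. a') (\<lambda>_. b') p"
    "pd 2 (rot_vec a b) p = b (p$1) *\<^sub>R
      vector [0, sin (p$2) * sin (p$3), - cos (p$2), - sin (p$2) * cos (p$3)]"
    "pd 3 (rot_vec a b) p = b (p$1) *\<^sub>R
      vector [0, - cos (p$2) * cos (p$3), 0, - cos (p$2) * sin (p$3)]"
    unfolding vec_eq_iff forall_4 nth unfolding rot_vec_def vector_4
    using c1 c2 c3 c4 by simp_all
qed

text \<open>On the sphere with metric \<open>dt\<^sup>2 + cos\<^sup>2 t dw\<^sup>2\<close>, the product \<open>G(t) K(w)\<close> is an eigenfunction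
  of the Laplacian with eigenvalue \<open>c\<close>; the equation is multiplied by \<open>cos\<^sup>2 t\<close>.\<close>

definition sph_harmonic :: "real \<Rightarrow> (real \<Rightarrow> real) \<Rightarrow> (real \<Rightarrow> real) \<Rightarrow> bool"
  where "sph_harmonic c G K \<longleftrightarrow> (\<exists>G1 G2 K1 K2. \<forall>t w.
    (G has_real_derivative G1 t) (at t) \<and> (G1 has_real_derivative G2 t) (at t) \<and>
    (K has_real_derivative K1 w) (at w) \<and> (K1 has_real_derivative K2 w) (at w) \<and>
    (cos t)\<^sup>2 * G2 t * K w + G t * K2 w - sin t * cos t * G1 t * K w
      = c * (cos t)\<^sup>2 * G t * K w)"

text \<open>These are the restrictions of a constant and, up to sign, of the three linear
  coordinates to the unit 2-sphere: harmonics of degree l = 0 and l = 1, with eigenvalue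
  -l(l+1).\<close>

lemma sph_harmonics:
  "sph_harmonic 0 (\<lambda>_. 1) (\<lambda>_. 1)" "sph_harmonic (-2) cos sin"
  "sph_harmonic (-2) sin (\<lambda>_. 1)" "sph_harmonic (-2) cos cos"
proof -
  show "sph_harmonic 0 (\<lambda>_. 1) (\<lambda>_. 1)"
    unfolding sph_harmonic_def by (rule exI[of _ "\<lambda>_. 0"])+ simp
  have c: "(cos has_real_derivative - sin t) (at t)"
    "((\<lambda>t. - sin t) has_real_derivative - cos t) (at t)" for t :: real
    by (auto intro!: derivative_eq_intros)
  have key: "(cos t)\<^sup>2 * - cos t * x + cos t * - x - sin t * cos t * - sin t * x
      = - 2 * (cos t)\<^sup>2 * cos t * x" for t x :: real
    using sin_cos_squared_add[of t] by algebra
  show "sph_harmonic (-2) cos sin"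
    unfolding sph_harmonic_def
    by (rule exI[of _ "\<lambda>t. - sin t"], rule exI[of _ "\<lambda>t. - cos t"],
      rule exI[of _ cos], rule exI[of _ "\<lambda>t. - sin t"])
      (intro allI conjI c DERIV_sin DERIV_cos key)
  show "sph_harmonic (-2) cos cos"
    unfolding sph_harmonic_def
    by (rule exI[of _ "\<lambda>t. - sin t"], rule exI[of _ "\<lambda>t. - cos t"],
      rule exI[of _ "\<lambda>t. - sin t"], rule exI[of _ "\<lambda>t. - cos t"])
      (intro allI conjI c key)
  show "sph_harmonic (-2) sin (\<lambda>_. 1)"
    unfolding sph_harmonic_def
    by (rule exI[of _ cos], rule exI[of _ "\<lambda>t. - sin t"],
      rule exI[of _ "\<lambda>_. 0"], rule exI[of _ "\<lambda>_. 0"])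
      (intro allI conjI c DERIV_sin DERIV_cos DERIV_const, simp add: power2_eq_square)
qed

section \<open>Frame, metric and principal curvatures of the rotational hypersurface\<close>

locale rotational_hypersurface =
  fixes f :: "real \<Rightarrow> real" and I :: "real set"
  assumes open_I: "open I" and zero_notin_I: "0 \<notin> I" and smooth_f: "smooth_on I f"
    and deriv_f_gt: "\<And>s. s \<in> I \<Longrightarrow> (deriv f s)\<^sup>2 > 1"
begin

abbreviation "h \<equiv> deriv f"
abbreviation "h' \<equiv> deriv h"
abbreviation "h'' \<equiv> deriv h'"
abbreviation "U \<equiv> rot_dom I"
abbreviation "X \<equiv> rot_param f"
abbreviation "N \<equiv> rot_gauss f"

definition W :: "real \<Rightarrow> real" where "W s = sqrt ((h s)\<^sup>2 - 1)"
definition metric_coeff :: "3 \<Rightarrow> real^3 \<Rightarrow> real" where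
  "metric_coeff i p = (if i = 1 then 1 - (h (p$1))\<^sup>2 else if i = 2 then (p$1)\<^sup>2 else (p$1 * cos (p$2))\<^sup>2)"
definition curvature :: "3 \<Rightarrow> real^3 \<Rightarrow> real" where
  "curvature i p = (if i = 1 then h' (p$1) / W (p$1) ^ 3 else - h (p$1) / (p$1 * W (p$1)))"

lemma W_pos: "s \<in> I \<Longrightarrow> W s > 0"
  using deriv_f_gt[of s] by (simp add: W_def)

lemma W_sq: "s \<in> I \<Longrightarrow> (W s)\<^sup>2 = (h s)\<^sup>2 - 1"
  using deriv_f_gt[of s] by (simp add: W_def)

lemma h_nonzero: "s \<in> I \<Longrightarrow> h s \<noteq> 0"
  using deriv_f_gt[of s] by auto

lemma smooth_h: "smooth_on I h" and smooth_h': "smooth_on I h'"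
  and smooth_h'': "smooth_on I h''"
  by (intro smooth_on_deriv open_I smooth_f)+

lemma smooth_inverse_W: "smooth_on I (\<lambda>s. 1 / W s)"
proof -
  have "smooth_on I (\<lambda>s. h s * h s + - 1)"
    by (intro smooth_on_add smooth_on_mult smooth_on_const open_I smooth_h)
  from smooth_on_inverse_sqrt[OF open_I this] show ?thesis
    using deriv_f_gt by (simp add: W_def power2_eq_square divide_inverse)
qed

lemma smooth_h_div_W: "smooth_on I (\<lambda>s. h s / W s)"
  using smooth_on_mult[OF open_I smooth_h smooth_inverse_W] by simp

lemma open_U: "open U"
  by (rule open_rot_dom[OF open_I])

lemma U_D:
  assumes "p \<in> U"
  shows "p$1 \<in> I" "p$1 \<noteq> 0" "cos (p$2) \<noteq> 0"
  using assms zero_notin_I by (auto simp: rot_dom_def)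

lemma N_eq: "N = rot_vec (\<lambda>s. 1 / W s) (\<lambda>s. h s / W s)"
  by (simp add: rot_gauss_eq W_def)

lemma DERIV_W: "s \<in> I \<Longrightarrow> (W has_real_derivative h s * h' s / W s) (at s)"
  using deriv_f_gt[of s] smooth_on_has_deriv[OF smooth_h, of s] unfolding W_def[abs_def]
  by (auto intro!: derivative_eq_intros simp: field_simps)

lemma DERIV_inverse_W:
  assumes "s \<in> I"
  shows "((\<lambda>s. 1 / W s) has_real_derivative - h s * h' s / W s ^ 3) (at s)"
proof -
  have "((\<lambda>s. 1 / W s) has_real_derivative - (h s * h' s / W s) / (W s * W s)) (at s)"
    using W_pos[OF assms] by (auto intro!: derivative_eq_intros DERIV_W assms)
  then show ?thesis by (simp add: power3_eq_cube mult.assoc)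
qed

lemma DERIV_h_div_W:
  assumes "s \<in> I"
  shows "((\<lambda>s. h s / W s) has_real_derivative - h' s / W s ^ 3) (at s)"
proof -
  have "((\<lambda>s. h s / W s) has_real_derivative
      (h' s * W s - h s * (h s * h' s / W s)) / (W s * W s)) (at s)"
    using W_pos[OF assms] smooth_on_has_deriv[OF smooth_h assms]
    by (auto intro!: derivative_eq_intros DERIV_W assms)
  \<comment> \<open>By \<open>W_sq\<close>, W^2 - h^2 = -1, which leaves only -h' in the
    numerator.\<close>
  moreover have "(h' s * W s - h s * (h s * h' s / W s)) / (W s * W s)
      = h' s * ((W s)\<^sup>2 - (h s)\<^sup>2) / W s ^ 3"
    using W_pos[OF assms] by (simp add: field_simps power2_eq_square power3_eq_cube)
  ultimately show ?thesis by (simp add: W_sq[OF assms])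
qed

lemma DERIV2_inverse_W:
  assumes "s \<in> I"
  shows "((\<lambda>s. - h s * h' s / W s ^ 3) has_real_derivative
    - ((h' s)\<^sup>2 + h s * h'' s) / W s ^ 3 + 3 * (h s)\<^sup>2 * (h' s)\<^sup>2 / W s ^ 5) (at s)"
proof -
  have "((\<lambda>s. - h s * h' s / W s ^ 3) has_real_derivative
      ((- h s * h'' s + - h' s * h' s) * W s ^ 3
        - (- h s * h' s) * (3 * (h s * h' s / W s) * (W s)\<^sup>2)) / (W s ^ 3 * W s ^ 3)) (at s)"
    using W_pos[OF assms] smooth_on_has_deriv[OF smooth_h assms] smooth_on_has_deriv[OF smooth_h' assms]
    by (auto intro!: derivative_eq_intros DERIV_W assms simp: field_simps)
  then show ?thesis
    by (rule DERIV_cong) (use W_pos[OF assms] in \<open>simp add: field_simps eval_nat_numeral\<close>)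
qed

lemma DERIV2_h_div_W:
  assumes "s \<in> I"
  shows "((\<lambda>s. - h' s / W s ^ 3) has_real_derivative
    - h'' s / W s ^ 3 + 3 * h s * (h' s)\<^sup>2 / W s ^ 5) (at s)"
proof -
  have "((\<lambda>s. - h' s / W s ^ 3) has_real_derivative
      (- h'' s * W s ^ 3
        - (- h' s) * (3 * (h s * h' s / W s) * (W s)\<^sup>2)) / (W s ^ 3 * W s ^ 3)) (at s)"
    using W_pos[OF assms] smooth_on_has_deriv[OF smooth_h' assms]
    by (auto intro!: derivative_eq_intros DERIV_W assms simp: field_simps)
  then show ?thesis
    by (rule DERIV_cong) (use W_pos[OF assms] in \<open>simp add: field_simps eval_nat_numeral\<close>)
qed

lemma pd_X:
  assumes "p \<in> U"
  shows "pd 1 X p = rot_vec h (\<lambda>_. 1) p"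
    and "pd 2 X p = p$1 *\<^sub>R
      vector [0, sin (p$2) * sin (p$3), - cos (p$2), - sin (p$2) * cos (p$3)]"
    and "pd 3 X p = p$1 *\<^sub>R
      vector [0, - cos (p$2) * cos (p$3), 0, - cos (p$2) * sin (p$3)]"
  using pd_rot_vec[OF open_I smooth_f smooth_on_id[OF open_I] assms
      smooth_on_has_deriv[OF smooth_f U_D(1)[OF assms]] DERIV_ident]
  by (simp_all add: rot_param_eq rot_vec_def)

text \<open>The derivative of the radial pair (1/W, h/W) is -h'/W^3 times (h, 1), the pair of the
  meridian tangent. In both angular directions the derivatives of \<open>N\<close> and
  \<open>X\<close> are the same vector scaled by h/W and by s.\<close>

lemma pd_N:
  assumes "p \<in> U"
  shows "- pd i N p = curvature i p *\<^sub>R pd i X p"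
proof -
  note pdN = pd_rot_vec[OF open_I smooth_inverse_W smooth_h_div_W assms
      DERIV_inverse_W[OF U_D(1)[OF assms]] DERIV_h_div_W[OF U_D(1)[OF assms]], folded N_eq]
  have "i = 1 \<or> i = 2 \<or> i = 3" by (rule exhaust_3)
  then show ?thesis
    using U_D(2)[OF assms]
    by (auto simp: pdN pd_X[OF assms] curvature_def rot_vec_def vec_eq_iff forall_4)
qed

lemma unit_sphere: "(cos t * sin w)\<^sup>2 + (sin t)\<^sup>2 + (cos t * cos w)\<^sup>2 = (1::real)"
  by (simp add: power_mult_distrib cos_squared_eq algebra_simps)

lemma metric_X:
  assumes "p \<in> U"
  shows "metric X p = diag_mat (\<lambda>i. metric_coeff i p)"
  unfolding vec_eq_iff forall_3 metric_def diag_mat_nth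
  by (simp add: pd_X[OF assms] lorentz_def rot_vec_def metric_coeff_def)
    (insert sin_cos_squared_add[of "p$2"] sin_cos_squared_add[of "p$3"], intro conjI; algebra)

lemma metric_coeff_nonzero:
  assumes "p \<in> U"
  shows "metric_coeff i p \<noteq> 0"
  using deriv_f_gt[OF U_D(1)[OF assms]] U_D(2,3)[OF assms] by (simp add: metric_coeff_def)

lemma shape_op_X: "p \<in> U \<Longrightarrow> shape_op X N p = diag_mat (\<lambda>i. curvature i p)"
  by (rule shape_op_eq_diag_mat[OF metric_X metric_coeff_nonzero pd_N])

text \<open>\<open>N\<close> is spacelike, so \<epsilon> = 1. In the plane spanned by the axis and
  the sphere point, \<open>N\<close> is (1, h)/W and the meridian tangent is (h, 1), with Lorentz
  product (-h + h)/W = 0.\<close>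

lemma oriented_hypersurface_X: "oriented_hypersurface U X N"
proof -
  have "det (metric X p) \<noteq> 0" if "p \<in> U" for p
    using metric_coeff_nonzero[OF that] by (simp add: metric_X[OF that] det_3 diag_mat_nth)
  moreover have "lorentz (N p) (pd i X p) = 0" if "p \<in> U" for p i
  proof -
    have "lorentz (N p) (pd 1 X p) = 0"
      using unit_sphere[of "p$2" "p$3"]
      by (simp add: pd_X[OF that] N_eq rot_vec_def lorentz_def) algebra
    moreover have "lorentz (N p) (pd 2 X p) = 0"
      using sin_cos_squared_add[of "p$3"]
      by (simp only: pd_X[OF that] N_eq rot_vec_def lorentz_def vector_4
          vector_scaleR_component real_scaleR_def) algebra
    moreover have "lorentz (N p) (pd 3 X p) = 0"
      by (simp add: pd_X[OF that] N_eq rot_vec_def lorentz_def)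
    ultimately show ?thesis
      using exhaust_3[of i] by auto
  qed
  moreover have "lorentz (N p) (N p) = 1" if "p \<in> U" for p
  proof -
    let ?W = "W (p$1)" and ?h = "h (p$1)"
    have "lorentz (N p) (N p) = (?h / ?W)\<^sup>2 - (1 / ?W)\<^sup>2"
      using unit_sphere[of "p$2" "p$3"]
      by (simp only: N_eq rot_vec_def lorentz_def vector_4) algebra
    also have "\<dots> = (?h\<^sup>2 - 1) / ?W\<^sup>2"
      by (simp add: power_divide diff_divide_distrib)
    also have "\<dots> = 1"
      unfolding W_sq[OF U_D(1)[OF that], symmetric] using W_pos[OF U_D(1)[OF that]] by simp
    finally show ?thesis .
  qed
  moreover have "smooth_on U X" "smooth_on U N"
    unfolding rot_param_eq N_eq
    by (intro smooth_on_rot_vec open_I smooth_f smooth_on_id smooth_inverse_W smooth_h_div_W)+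
  ultimately show ?thesis
    unfolding oriented_hypersurface_def using open_U by blast
qed

text \<open>The Hessian of \<open>\<alpha>(s) Y(t,w)\<close> with \<open>\<Delta>Y = c Y\<close> enters \<open>L\<^sub>1\<close> only through its radial entry and the sum
  of its two angular entries, since the principal curvature \<open>- h / (s W)\<close> is double.\<close>

definition radial_L :: "real \<Rightarrow> real \<Rightarrow> real \<Rightarrow> real \<Rightarrow> real \<Rightarrow> real"
  where "radial_L c x x' x'' s =
    2 * h s / (s * W s) * (- x'' / (W s)\<^sup>2 + h s * h' s * x' / W s ^ 4)
    + (h s / (s * W s) - h' s / W s ^ 3) * (c * x / s\<^sup>2 - 2 * x' / (s * (W s)\<^sup>2))"

lemma L_op_separated:
  assumes p: "p \<in> U" and \<phi>: "\<And>q. q \<in> U \<Longrightarrow> \<phi> q = \<alpha> (q$1) * G (q$2) * K (q$3)"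
    and \<alpha>': "\<And>s. s \<in> I \<Longrightarrow> (\<alpha> has_real_derivative \<alpha>' s) (at s)"
    and \<alpha>'': "\<And>s. s \<in> I \<Longrightarrow> (\<alpha>' has_real_derivative \<alpha>'' s) (at s)"
    and "sph_harmonic c G K"
  shows "L_op 1 X N \<phi> p = radial_L c (\<alpha> (p$1)) (\<alpha>' (p$1)) (\<alpha>'' (p$1)) (p$1) * G (p$2) * K (p$3)"
proof -
  obtain G1 G2 K1 K2 where
    G: "\<And>t. (G has_real_derivative G1 t) (at t)" "\<And>t. (G1 has_real_derivative G2 t) (at t)"
    and K: "\<And>w. (K has_real_derivative K1 w) (at w)" "\<And>w. (K1 has_real_derivative K2 w) (at w)"
    and harm: "\<And>t w. (cos t)\<^sup>2 * G2 t * K w + G t * K2 w - sin t * cos t * G1 t * K w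
      = c * (cos t)\<^sup>2 * G t * K w"
    using assms(5) unfolding sph_harmonic_def by metis
  define s t w where "s = p$1" and "t = p$2" and "w = p$3"
  have s: "s \<in> I" "s \<noteq> 0" and ct: "cos t \<noteq> 0"
    using U_D[OF p] by (simp_all add: s_def t_def)
  note W0 = W_pos[OF s(1)]
  note sep = pd_separated[OF open_U p, folded s_def t_def w_def]
  have dphi: "pd 1 \<phi> q = \<alpha>' (q$1) * G (q$2) * K (q$3)"
    "pd 2 \<phi> q = \<alpha> (q$1) * G1 (q$2) * K (q$3)"
    "pd 3 \<phi> q = \<alpha> (q$1) * G (q$2) * K1 (q$3)" if "q \<in> U" for q
    by (rule pd_separated[OF open_U that \<phi> \<alpha>'[OF U_D(1)[OF that]] G(1) K(1)], assumption)+
  have g1: "pd 1 (metric_coeff 1) p = - 2 * h s * h' s" "pd 2 (metric_coeff 1) p = 0"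
    "pd 3 (metric_coeff 1) p = 0"
  proof -
    have D: "((\<lambda>s. 1 - (h s)\<^sup>2) has_real_derivative - 2 * h s * h' s) (at s)"
      using smooth_on_has_deriv[OF smooth_h s(1)] by (auto intro!: derivative_eq_intros)
    show "pd 1 (metric_coeff 1) p = - 2 * h s * h' s" "pd 2 (metric_coeff 1) p = 0"
      "pd 3 (metric_coeff 1) p = 0"
      using sep[of "metric_coeff 1", OF _ D DERIV_const[of 1] DERIV_const[of 1]]
      by (simp_all add: metric_coeff_def)
  qed
  have g2: "pd 1 (metric_coeff 2) p = 2 * s" "pd 2 (metric_coeff 2) p = 0"
    "pd 3 (metric_coeff 2) p = 0"
  proof -
    have D: "((\<lambda>s. s\<^sup>2) has_real_derivative 2 * s) (at s)"
      by (auto intro!: derivative_eq_intros)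
    show "pd 1 (metric_coeff 2) p = 2 * s" "pd 2 (metric_coeff 2) p = 0"
      "pd 3 (metric_coeff 2) p = 0"
      using sep[of "metric_coeff 2", OF _ D DERIV_const[of 1] DERIV_const[of 1]]
      by (simp_all add: metric_coeff_def)
  qed
  have g3: "pd 1 (metric_coeff 3) p = 2 * s * (cos t)\<^sup>2"
    "pd 2 (metric_coeff 3) p = s\<^sup>2 * (- 2 * sin t * cos t)" "pd 3 (metric_coeff 3) p = 0"
  proof -
    have D: "((\<lambda>s. s\<^sup>2) has_real_derivative 2 * s) (at s)"
      "((\<lambda>t. (cos t)\<^sup>2) has_real_derivative - 2 * sin t * cos t) (at t)"
      by (auto intro!: derivative_eq_intros)
    show "pd 1 (metric_coeff 3) p = 2 * s * (cos t)\<^sup>2"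
      "pd 2 (metric_coeff 3) p = s\<^sup>2 * (- 2 * sin t * cos t)" "pd 3 (metric_coeff 3) p = 0"
      using sep[of "metric_coeff 3", OF _ D DERIV_const[of 1]]
      by (simp_all add: metric_coeff_def power_mult_distrib)
  qed
  have gval: "metric_coeff 1 p = - (W s)\<^sup>2" "metric_coeff 2 p = s\<^sup>2" "metric_coeff 3 p = s\<^sup>2 * (cos t)\<^sup>2"
    using W_sq[OF s(1)] by (simp_all add: metric_coeff_def s_def t_def power_mult_distrib)
  have h1: "pd 1 (\<lambda>q. pd 1 \<phi> q / metric_coeff 1 q) p
      = (- \<alpha>'' s / (W s)\<^sup>2 + 2 * h s * h' s * \<alpha>' s / W s ^ 4) * G t * K w"
  proof -
    have "((\<lambda>s. - \<alpha>' s / (W s)\<^sup>2) has_real_derivative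
        ((- \<alpha>'' s) * (W s)\<^sup>2 - (- \<alpha>' s) * (2 * (h s * h' s / W s) * W s)) / ((W s)\<^sup>2 * (W s)\<^sup>2)) (at s)"
      using W0 by (auto intro!: derivative_eq_intros DERIV_W \<alpha>'' s simp: field_simps)
    then have "((\<lambda>s. - \<alpha>' s / (W s)\<^sup>2) has_real_derivative
        - \<alpha>'' s / (W s)\<^sup>2 + 2 * h s * h' s * \<alpha>' s / W s ^ 4) (at s)"
      by (rule DERIV_cong) (use W0 in \<open>simp add: field_simps eval_nat_numeral\<close>)
    moreover have "pd 1 \<phi> q / metric_coeff 1 q = - \<alpha>' (q$1) / (W (q$1))\<^sup>2 * G (q$2) * K (q$3)"
      if "q \<in> U" for q
    proof -
      have "metric_coeff 1 q = - (W (q$1))\<^sup>2"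
        using W_sq[OF U_D(1)[OF that]] by (simp add: metric_coeff_def)
      then show ?thesis by (simp add: dphi[OF that])
    qed
    ultimately show ?thesis
      by (intro sep(1)[OF _ _ G(1) K(1)])
  qed
  have h2: "pd 2 (\<lambda>q. pd 2 \<phi> q / metric_coeff 2 q) p = \<alpha> s / s\<^sup>2 * G2 t * K w"
  proof -
    have "((\<lambda>s. \<alpha> s / s\<^sup>2) has_real_derivative (\<alpha>' s * s\<^sup>2 - \<alpha> s * (2 * s)) / (s\<^sup>2 * s\<^sup>2)) (at s)"
      using s(2) by (auto intro!: derivative_eq_intros \<alpha>' s simp: field_simps)
    then show ?thesis
      by (intro sep(2)[OF _ _ G(2) K(1)]) (auto simp: dphi metric_coeff_def)
  qed
  have h3: "pd 3 (\<lambda>q. pd 3 \<phi> q / metric_coeff 3 q) p = \<alpha> s / s\<^sup>2 * (G t / (cos t)\<^sup>2) * K2 w"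
  proof -
    have "((\<lambda>s. \<alpha> s / s\<^sup>2) has_real_derivative (\<alpha>' s * s\<^sup>2 - \<alpha> s * (2 * s)) / (s\<^sup>2 * s\<^sup>2)) (at s)"
      using s(2) by (auto intro!: derivative_eq_intros \<alpha>' s simp: field_simps)
    moreover have "((\<lambda>t. G t / (cos t)\<^sup>2) has_real_derivative
        (G1 t * (cos t)\<^sup>2 - G t * (- 2 * sin t * cos t)) / ((cos t)\<^sup>2 * (cos t)\<^sup>2)) (at t)"
      using ct by (auto intro!: derivative_eq_intros G simp: field_simps)
    ultimately show ?thesis
      by (intro sep(3)[OF _ _ _ K(2)]) (auto simp: dphi metric_coeff_def power_mult_distrib)
  qed
  \<comment> \<open>\<open>\<nu>\<close> is the meridian principal curvature and
    \<open>- \<mu>\<close> the double one, so P_1 has the eigenvalues 2\<mu>, \<mu> - \<nu>, \<mu> -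
    \<nu>.\<close>
  define \<mu> where "\<mu> = h s / (s * W s)"
  define \<nu> where "\<nu> = h' s / W s ^ 3"
  have \<kappa>: "curvature 1 p = \<nu>" "curvature 2 p = - \<mu>" "curvature 3 p = - \<mu>"
    by (simp_all add: curvature_def \<mu>_def \<nu>_def s_def)
  \<comment> \<open>\<open>T1\<close>, \<open>T2\<close>, \<open>T3\<close> are the simplified
    diagonal entries of the Hessian operator. In \<open>T1\<close> the Christoffel term cancels half
    of what differentiating 1/W^2 contributes; in \<open>T3\<close> the term with sin t / cos t
    stems from the dependence of the third metric coefficient on t.\<close>
  define T1 where "T1 = (- \<alpha>'' s / (W s)\<^sup>2 + h s * h' s * \<alpha>' s / W s ^ 4) * G t * K w"
  define T2 where "T2 = \<alpha> s / s\<^sup>2 * G2 t * K w - \<alpha>' s * G t * K w / (s * (W s)\<^sup>2)"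
  define T3 where "T3 = \<alpha> s / s\<^sup>2 * (G t / (cos t)\<^sup>2) * K2 w
    - \<alpha>' s * G t * K w / (s * (W s)\<^sup>2) - sin t / cos t * (\<alpha> s / s\<^sup>2 * G1 t * K w)"
  note dphi_p = dphi[OF p, folded s_def t_def w_def]
  define H where "H i = pd i (\<lambda>q. pd i \<phi> q / metric_coeff i q) p
    + (\<Sum>k\<in>UNIV. pd k (metric_coeff i) p * pd k \<phi> p / (2 * metric_coeff i p * metric_coeff k p))" for i
  have hess1: "H 1 = T1"
    unfolding H_def h1 sum_3 g1 gval dphi_p T1_def using W0
    by (simp add: field_simps eval_nat_numeral)
  have hess2: "H 2 = T2"
    unfolding H_def h2 sum_3 g2 gval dphi_p T2_def using W0 s(2)
    by (simp add: field_simps eval_nat_numeral)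
  have hess3: "H 3 = T3"
    unfolding H_def h3 sum_3 g3 gval dphi_p T3_def using W0 s(2) ct
    by (simp add: field_simps eval_nat_numeral)
  \<comment> \<open>Dividing the harmonic equation by (cos t)^2, nonzero on the domain, gives the
    usual spherical Laplacian. Up to the factor \<alpha>/s^2, the angular derivatives in
    \<open>T2\<close> and \<open>T3\<close> add up to it.\<close>
  have "G2 t * K w + G t * K2 w / (cos t)\<^sup>2 - sin t / cos t * G1 t * K w = c * G t * K w"
    using harm[of t w] ct by (simp add: field_simps power2_eq_square)
  moreover have "T2 + T3 = \<alpha> s / s\<^sup>2 * (G2 t * K w + G t * K2 w / (cos t)\<^sup>2 - sin t / cos t * G1 t * K w)
      - 2 * \<alpha>' s / (s * (W s)\<^sup>2) * G t * K w"
    unfolding T2_def T3_def by (simp add: algebra_simps)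
  ultimately have T23: "T2 + T3 = (c * \<alpha> s / s\<^sup>2 - 2 * \<alpha>' s / (s * (W s)\<^sup>2)) * G t * K w"
    by (simp add: algebra_simps)
  have "L_op 1 X N \<phi> p
      = (\<Sum>i\<in>UNIV. (curvature i p - (curvature 1 p + curvature 2 p + curvature 3 p)) * H i)"
    unfolding H_def
    by (rule L_op_1_diag[OF open_U p metric_X metric_coeff_nonzero shape_op_X[OF p]])
  also have "\<dots> = 2 * \<mu> * T1 + (\<mu> - \<nu>) * (T2 + T3)"
    unfolding sum_3 hess1 hess2 hess3 \<kappa> by (simp add: algebra_simps)
  also have "\<dots> = radial_L c (\<alpha> s) (\<alpha>' s) (\<alpha>'' s) s * G t * K w"
  proof -
    have "radial_L c (\<alpha> s) (\<alpha>' s) (\<alpha>'' s) s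
      = 2 * \<mu> * (- \<alpha>'' s / (W s)\<^sup>2 + h s * h' s * \<alpha>' s / W s ^ 4)
        + (\<mu> - \<nu>) * (c * \<alpha> s / s\<^sup>2 - 2 * \<alpha>' s / (s * (W s)\<^sup>2))"
      by (simp add: radial_L_def \<mu>_def \<nu>_def)
    then show ?thesis
      unfolding T23 T1_def by (simp only: distrib_right mult.assoc)
  qed
  finally show ?thesis
    unfolding s_def t_def w_def .
qed

section \<open>L_1 of the Gauss map\<close>

lemma radial_L_minus: "radial_L c (- x) (- x') (- x'') s = - radial_L c x x' x'' s"
  by (simp add: radial_L_def algebra_simps)

text \<open>\<open>A\<close> and \<open>B\<close> are the radial coefficients of the time and space
  components of L_1 N. The arguments of \<open>radial_L\<close> are the eigenvalue of the angular
  factor, then the radial part of \<open>N\<close> with its first two derivatives.\<close>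

definition A where
  "A s = radial_L 0 (1 / W s) (- h s * h' s / W s ^ 3)
    (- ((h' s)\<^sup>2 + h s * h'' s) / W s ^ 3 + 3 * (h s)\<^sup>2 * (h' s)\<^sup>2 / W s ^ 5) s"

definition B where
  "B s = radial_L (-2) (h s / W s) (- h' s / W s ^ 3)
    (- h'' s / W s ^ 3 + 3 * h s * (h' s)\<^sup>2 / W s ^ 5) s"

lemma L_vec_N:
  assumes "p \<in> U"
  shows "L_vec 1 X N N p = rot_vec A B p"
proof -
  note L = L_op_separated[OF assms]
  have "L_op 1 X N (\<lambda>q. N q $ 1) p = A (p$1)"
    using L[OF _ DERIV_inverse_W DERIV2_inverse_W sph_harmonics(1), of "\<lambda>q. N q $ 1"]
    by (simp add: N_eq rot_vec_def A_def)
  \<comment> \<open>The second and third components of \<open>N\<close> carry the radial factor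
    -h/W; \<open>radial_L_minus\<close> pulls the sign out.\<close>
  moreover have "L_op 1 X N (\<lambda>q. N q $ 2) p = - B (p$1) * cos (p$2) * sin (p$3)"
    using L[OF _ DERIV_minus[OF DERIV_h_div_W] DERIV_minus[OF DERIV2_h_div_W] sph_harmonics(2),
        of "\<lambda>q. N q $ 2", unfolded radial_L_minus]
    by (simp only: N_eq rot_vec_def B_def vector_4)
  moreover have "L_op 1 X N (\<lambda>q. N q $ 3) p = - B (p$1) * sin (p$2)"
    using L[OF _ DERIV_minus[OF DERIV_h_div_W] DERIV_minus[OF DERIV2_h_div_W] sph_harmonics(3),
        of "\<lambda>q. N q $ 3", unfolded radial_L_minus]
    by (simp only: N_eq rot_vec_def B_def vector_4 mult_1_right)
  moreover have "L_op 1 X N (\<lambda>q. N q $ 4) p = B (p$1) * cos (p$2) * cos (p$3)"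
    using L[OF _ DERIV_h_div_W DERIV2_h_div_W sph_harmonics(4), of "\<lambda>q. N q $ 4"]
    by (simp only: N_eq rot_vec_def B_def vector_4)
  ultimately show ?thesis
    by (simp add: L_vec_def rot_vec_def vec_eq_iff forall_4)
qed

text \<open>Numerators of \<open>A\<close> and \<open>B\<close> over the common denominator s^3 W^8.
  Only even powers of W occur in them, written through h^2 - 1, so both are polynomials in s, h, h',
  h''. This confines the square root to the factor 1 + C W of the differential equation.\<close>

definition A_num where
  "A_num s = 2 * s\<^sup>2 * h s * (((h' s)\<^sup>2 + h s * h'' s) * ((h s)\<^sup>2 - 1) - 4 * (h s)\<^sup>2 * (h' s)\<^sup>2)
    + (h s * ((h s)\<^sup>2 - 1) - s * h' s) * (2 * s * h s * h' s)"

definition B_num where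
  "B_num s = 2 * s\<^sup>2 * h s * (h'' s * ((h s)\<^sup>2 - 1) - 4 * h s * (h' s)\<^sup>2)
    + (h s * ((h s)\<^sup>2 - 1) - s * h' s) * (2 * s * h' s - 2 * h s * ((h s)\<^sup>2 - 1)\<^sup>2)"

lemma A_eq:
  assumes "s \<in> I"
  shows "A s = A_num s / (s ^ 3 * W s ^ 8)"
proof -
  have "W s \<noteq> 0" "s \<noteq> 0"
    using W_pos[OF assms] assms zero_notin_I by auto
  then show ?thesis
    unfolding A_def A_num_def radial_L_def W_sq[OF assms, symmetric]
    by (simp add: field_simps eval_nat_numeral)
qed

lemma B_eq:
  assumes "s \<in> I"
  shows "B s = B_num s / (s ^ 3 * W s ^ 8)"
proof -
  have "W s \<noteq> 0" "s \<noteq> 0"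
    using W_pos[OF assms] assms zero_notin_I by auto
  then show ?thesis
    unfolding B_def B_num_def radial_L_def W_sq[OF assms, symmetric]
    by (simp add: field_simps eval_nat_numeral)
qed

section \<open>The proportionality factor as a smooth function on the hypersurface\<close>

definition factor where
  "factor s = W s * B s / h s"

lemma smooth_factor: "smooth_on I factor"
proof (rule smooth_on_cong)
  show "open I" by (rule open_I)
  \<comment> \<open>The W in the definition of \<open>factor\<close> cancels one of the eight powers
    in the denominator of \<open>B\<close>; seven factors 1/W remain.\<close>
  show "factor s = B_num s * inverse (s * s * s * h s)
      * (1 / W s) * ((1 / W s) * (1 / W s)) * ((1 / W s) * (1 / W s)) * ((1 / W s) * (1 / W s))"
    if "s \<in> I" for s
    using W_pos[OF that] h_nonzero[OF that]
    by (simp add: factor_def B_eq[OF that] field_simps eval_nat_numeral)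
  have "smooth_on I (\<lambda>s. 2 * (s * s) * h s * (h'' s * (h s * h s + - 1) + - 4 * h s * (h' s * h' s))
      + (h s * (h s * h s + - 1) + - 1 * s * h' s)
        * (2 * s * h' s + - 2 * h s * ((h s * h s + - 1) * (h s * h s + - 1))))"
    by (intro smooth_on_add smooth_on_mult smooth_on_const smooth_on_id smooth_h smooth_h'
        smooth_h'' open_I)
  then have B_num: "smooth_on I B_num"
    by (simp add: B_num_def[abs_def] power2_eq_square)
  have "smooth_on I (\<lambda>s. inverse (s * s * s * h s))"
    using zero_notin_I h_nonzero
    by (intro smooth_on_inverse smooth_on_mult smooth_on_id open_I smooth_h) auto
  then show "smooth_on I (\<lambda>s. B_num s * inverse (s * s * s * h s)
      * (1 / W s) * ((1 / W s) * (1 / W s)) * ((1 / W s) * (1 / W s)) * ((1 / W s) * (1 / W s)))"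
    by (intro smooth_on_mult B_num smooth_inverse_W open_I)
qed

text \<open>\<open>s\<^sup>2\<close> determines \<open>s\<close> because an interval avoiding \<open>0\<close> has a fixed sign.\<close>

definition meridian_param :: "real^4 \<Rightarrow> real"
  where "meridian_param x = (THE s. s \<in> I \<and> s\<^sup>2 = (x$2)\<^sup>2 + (x$3)\<^sup>2 + (x$4)\<^sup>2)"

lemma meridian_param_X:
  assumes "is_interval I" "p \<in> U"
  shows "meridian_param (X p) = p$1"
  unfolding meridian_param_def
proof (rule the_equality)
  \<comment> \<open>The spatial part of \<open>X p\<close> is s times a unit vector, so its squared
    length recovers s^2.\<close>
  have eq: "(X p $ 2)\<^sup>2 + (X p $ 3)\<^sup>2 + (X p $ 4)\<^sup>2 = (p$1)\<^sup>2"
    using unit_sphere[of "p$2" "p$3"]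
    by (simp only: rot_param_eq rot_vec_def vector_4) algebra
  then show "p$1 \<in> I \<and> (p$1)\<^sup>2 = (X p $ 2)\<^sup>2 + (X p $ 3)\<^sup>2 + (X p $ 4)\<^sup>2"
    using U_D(1)[OF assms(2)] by simp
  fix s assume s: "s \<in> I \<and> s\<^sup>2 = (X p $ 2)\<^sup>2 + (X p $ 3)\<^sup>2 + (X p $ 4)\<^sup>2"
  show "s = p$1"
  proof (rule ccontr)
    assume "s \<noteq> p$1"
    with s eq have "s = - p$1" by (auto simp: power2_eq_iff)
    then have "s \<le> 0 \<and> 0 \<le> p$1 \<or> p$1 \<le> 0 \<and> 0 \<le> s" by linarith
    then have "0 \<in> I"
      using s U_D(1)[OF assms(2)] assms(1) unfolding is_interval_1 by blast
    with zero_notin_I show False by simp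
  qed
qed

text \<open>Composition with \<open>meridian_param\<close> makes the radial factor a function of
  points, so all parameters of one point receive the same value. Its pullback along \<open>X\<close>
  depends on s alone, which gives smoothness.\<close>

lemma L_gauss_eq_factor:
  assumes "is_interval I"
    and nz: "\<exists>p\<in>U. L_vec 1 X N N p \<noteq> 0"
    and ode: "\<And>s. s \<in> I \<Longrightarrow> h s * A_num s = (1 + C * W s) * B_num s"
  shows "L_gauss_eq 1 U X N (factor \<circ> meridian_param) (vector [C, 0, 0, 0])"
proof -
  have m: "(factor \<circ> meridian_param) (X p) = factor (p$1)" if "p \<in> U" for p
    by (simp add: meridian_param_X[OF assms(1) that])
  have L: "L_vec 1 X N N p = (factor \<circ> meridian_param) (X p) *\<^sub>R (N p + vector [C, 0, 0, 0])"
    if "p \<in> U" for p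
  proof -
    note s = U_D(1)[OF that]
    \<comment> \<open>\<open>A\<close> and \<open>B\<close> share one denominator, so the relation
      between the numerators passes to them.\<close>
    have "h (p$1) * A (p$1) = (1 + C * W (p$1)) * B (p$1)"
      using ode[OF s] by (simp add: A_eq[OF s] B_eq[OF s])
    then have "A (p$1) = (1 + C * W (p$1)) * B (p$1) / h (p$1)"
      using h_nonzero[OF s] by (simp add: eq_divide_eq mult.commute)
    also have "\<dots> = factor (p$1) * (1 / W (p$1) + C)"
      using W_pos[OF s] h_nonzero[OF s] by (simp add: factor_def field_simps)
    finally have "A (p$1) = factor (p$1) * (1 / W (p$1) + C)" .
    moreover have "B (p$1) = factor (p$1) * (h (p$1) / W (p$1))"
      using W_pos[OF s] h_nonzero[OF s] by (simp add: factor_def)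
    ultimately show ?thesis
      unfolding m[OF that] L_vec_N[OF that]
      by (simp add: N_eq rot_vec_def vec_eq_iff forall_4)
  qed
  have "smooth_on U ((factor \<circ> meridian_param) \<circ> X)"
  proof (rule smooth_on_cong[OF open_U])
    show "smooth_on U (\<lambda>p. factor (p$1))"
      by (rule smooth_on_component[OF open_U open_I smooth_factor U_D(1)])
  qed (use m in simp)
  \<comment> \<open>At a point where L_1 N does not vanish, the identity \<open>L\<close> excludes a
    zero of the factor.\<close>
  moreover have "\<exists>x\<in>X ` U. (factor \<circ> meridian_param) x \<noteq> 0"
    using nz L by fastforce
  ultimately show ?thesis
    unfolding L_gauss_eq_def using L by blast
qed

end

section \<open>From the differential equation to the second kind property\<close>

theorem theorem8:
  fixes f :: "real \<Rightarrow> real" and I :: "real set" and C\<^sub>1 :: real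
  assumes "open I" and "is_interval I" and "0 \<notin> I"
    and "smooth_on I f"
    and "\<forall>s\<in>I. (deriv f s)\<^sup>2 > 1"
    and "C\<^sub>1 \<noteq> 0"
    and "\<exists>p\<in>rot_dom I. L_vec 1 (rot_param f) (rot_gauss f) (rot_gauss f) p \<noteq> 0"
    and "\<forall>s\<in>I. let f' = deriv f s; f'' = deriv (deriv f) s; f''' = deriv (deriv (deriv f)) s in
      0 = (1 + C\<^sub>1 * sqrt (f'^2 - 1)) *
            (- 2 * f'^2 * (f'^2 - 1)^3 + 2 * s * (f'^2 - 1) * f'^3 * f''
             - 2 * s^2 * (4 * f'^2 + 1) * f''^2 + 2 * s^2 * (f'^2 - 1) * f' * f''')
          - 2 * s * ((f' * (f'^2 - 1) - s * (3 * f'^2 + 2) * f'') * f''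
                     + s * (f'^2 - 1) * f' * f''') * f'^2"
  shows "second_kind_L_pointwise_1_type 1 (rot_dom I) (rot_param f) (rot_gauss f) \<and>
    (\<exists>m. L_gauss_eq 1 (rot_dom I) (rot_param f) (rot_gauss f) m (vector [C\<^sub>1, 0, 0, 0]))"
proof -
  interpret rotational_hypersurface f I
    using assms by unfold_locales auto
  \<comment> \<open>After expansion, \<open>B_num s\<close> is the bracket multiplied by
    \<open>1 + C\<^sub>1 * W s\<close>, and \<open>h s * A_num s\<close> is the subtracted last
    term. The differential equation is thus a rearrangement of this identity, with the square root
    treated as an indeterminate.\<close>
  have "h s * A_num s = (1 + C\<^sub>1 * W s) * B_num s" if "s \<in> I" for s
    using assms(8)[rule_format, OF that] unfolding Let_def A_num_def B_num_def W_def
    by algebra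
  then have "L_gauss_eq 1 U X N (factor \<circ> meridian_param) (vector [C\<^sub>1, 0, 0, 0])"
    by (rule L_gauss_eq_factor[OF assms(2,7)])
  moreover have "(vector [C\<^sub>1, 0, 0, 0] :: real^4) \<noteq> 0"
    using assms(6) by (metis vector_4(1) zero_index)
  ultimately show ?thesis
    using oriented_hypersurface_X unfolding second_kind_L_pointwise_1_type_def by blast
qed

end
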